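(* Let $(A,\varrho_A,[\cdot,\cdot])$ be a skew-symmetric algebroid over a manifold $M$ equipped with a pseudo-Riemannian metric $g\in\Gamma(\mathsf{S}^2A^* )$ in the vector bundle $A$ and an $A$-connection $\nabla$ in $A$. Then for all $X,Z\in\Gamma(A)$, $$g(\nabla_XX,Z)=g\Big(\sharp\big(\mathcal{L}^a_XX^\flat-\tfrac12 d^a(g(X,X))\big),Z\Big)-g(T^\nabla(X,Z),X)+(\nabla g)(Z,X,X)-\tfrac12(d^sg)(X,X,Z).$$ In particular, if $\nabla$ is a connection with totally skew-symmetric torsion with respect to $g$ and is compatible with $g$ (i.e. $\nabla g=0$), then for all $X\in\Gamma(A)$, $$\nabla_XX=\sharp\big(\mathcal{L}^a_XX^\flat-\tfrac12 d^a(g(X,X))\big).$$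
   Context: A skew-symmetric algebroid $(A,\varrho_A,[\cdot,\cdot])$ over $M$ is a vector bundle $A\to M$ with a vector bundle homomorphism $\varrho_A:A\to TM$ over the identity (anchor) and an $\mathbb{R}$-bilinear skew-symmetric map $[\cdot,\cdot]:\Gamma(A)\times\Gamma(A)\to\Gamma(A)$ with $[X,fY]=f[X,Y]+(\varrho_A\circ X)(f)\,Y$ for $X,Y\in\Gamma(A)$, $f\in C^\infty(M)$ (no Jacobi identity is assumed, and the anchor need not preserve brackets). An $A$-connection in $A$ is an $\mathbb{R}$-bilinear map $\nabla:\Gamma(A)\times\Gamma(A)\to\Gamma(A)$ with $\nabla_{fX}Y=f\nabla_XY$ and $\nabla_X(fY)=f\nabla_XY+(\varrho_A\circ X)(f)Y$. Its torsion is $T^\nabla(X,Y)=\nabla_XY-\nabla_YX-[X,Y]$. It is extended to covariant tensors by $(\nabla_X\zeta)(X_1,\dots,X_k)=(\varrho_A\circ X)(\zeta(X_1,\dots,X_k))-\sum_j\zeta(X_1,\dots,\nabla_XX_j,\dots,X_k)$, and $(\nabla\zeta)(X_1,\dots,X_{k+1})=(\nabla_{X_1}\zeta)(X_2,\dots,X_{k+1})$. The symmetrized covariant derivative of a symmetric tensor $\eta\in\Gamma(\mathsf{S}^kA^* )$ is $(d^s\eta)(X_1,\dots,X_{k+1})=\sum_{j=1}^{k+1}(\nabla_{X_j}\eta)(X_1,\dots,\widehat{X}_j,\dots,X_{k+1})$. The connection $\nabla$ has totally skew-symmetric torsion with respect to $g$ if $T^g(X,Y,Z)=g(T^\nabla(X,Y),Z)$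 is a $3$-form, i.e. $T^g\in\Gamma(\bigwedge^3A^* )$. A pseudo-Riemannian metric $g$ in $A$ is a nondegenerate section of $\mathsf{S}^2A^*$; $X^\flat=g(X,\cdot)$ and $\sharp:A^*\to A$ is given by $g(\sharp(\omega),X)=\omega(X)$. For $f\in C^\infty(M)$, $(d^af)(X)=(\varrho_A\circ X)(f)$. The (alternating) Lie derivative of $\omega\in\Gamma(A^* )$ is $(\mathcal{L}^a_X\omega)(Y)=(\varrho_A\circ X)(\omega(Y))-\omega([X,Y])$. *)

theory Defs
  imports "HOL-Analysis.Analysis"
begin

section \<open>Smooth maps between finite-dimensional normed spaces\<close>

text \<open>
  Model spaces are normed spaces spanned by a finite set rather than members of class
  \<open>euclidean_space\<close>, because the latter have positive dimension, which would exclude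
  zero-dimensional manifolds and bundles of rank zero.
\<close>

definition finite_dim :: "'a::real_vector itself \<Rightarrow> bool" where
  "finite_dim _ \<longleftrightarrow> (\<exists>B :: 'a set. finite B \<and> span B = UNIV)"

text \<open>
  Used only for open sets and finite-dimensional domains, where continuity of all iterated
  directional derivatives of order at most \<open>k\<close> is the usual \<open>C\<close>-\<open>k\<close> property.
\<close>

primrec Ck_on :: "nat \<Rightarrow> 'a::real_normed_vector set \<Rightarrow> ('a \<Rightarrow> 'b::real_normed_vector) \<Rightarrow> bool" where
  "Ck_on 0 S = (\<lambda>f. continuous_on S f)"
| "Ck_on (Suc k) S = (\<lambda>f. (\<forall>x\<in>S. f differentiable (at x)) \<and>
     (\<forall>v. Ck_on k S (\<lambda>x. frechet_derivative f (at x) v)))"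

definition smooth_on :: "'a::real_normed_vector set \<Rightarrow> ('a \<Rightarrow> 'b::real_normed_vector) \<Rightarrow> bool" where
  "smooth_on S f \<longleftrightarrow> (\<forall>k. Ck_on k S f)"


section \<open>Smooth manifolds\<close>

text \<open>
  The manifold is the whole type \<open>'m\<close>; its smooth structure is given by a (not necessarily
  maximal) atlas of charts \<open>(U, \<phi>)\<close>, where only the values of \<open>\<phi>\<close> on \<open>U\<close> matter.
\<close>

definition smooth_manifold ::
  "('m::{t2_space,second_countable_topology} set \<times> ('m \<Rightarrow> 'e::real_normed_vector)) set \<Rightarrow> bool" where
  "smooth_manifold At \<longleftrightarrow>
     finite_dim TYPE('e) \<and>
     (\<Union>(U, \<phi>)\<in>At. U) = UNIV \<and>
     (\<forall>(U, \<phi>)\<in>At. open U \<and> open (\<phi> ` U) \<and> homeomorphism U (\<phi> ` U) \<phi> (inv_into U \<phi>)) \<and>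
     (\<forall>(U, \<phi>)\<in>At. \<forall>(V, \<psi>)\<in>At. smooth_on (\<phi> ` (U \<inter> V)) (\<psi> \<circ> inv_into U \<phi>))"

definition smooth_map_on ::
  "('m set \<times> ('m \<Rightarrow> 'e::real_normed_vector)) set \<Rightarrow> 'm set \<Rightarrow> ('m \<Rightarrow> 'b::real_normed_vector) \<Rightarrow> bool" where
  "smooth_map_on At W f \<longleftrightarrow> (\<forall>(U, \<phi>)\<in>At. smooth_on (\<phi> ` (U \<inter> W)) (f \<circ> inv_into U \<phi>))"

definition smooth_functions ::
  "('m set \<times> ('m \<Rightarrow> 'e::real_normed_vector)) set \<Rightarrow> ('m \<Rightarrow> real) set" where
  "smooth_functions At = {f. smooth_map_on At UNIV f}"

text \<open>Tangent vectors at \<open>p\<close> are derivations at \<open>p\<close> of the algebra of smooth functions.\<close>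

definition tangent_vector ::
  "('m set \<times> ('m \<Rightarrow> 'e::real_normed_vector)) set \<Rightarrow> 'm \<Rightarrow> (('m \<Rightarrow> real) \<Rightarrow> real) \<Rightarrow> bool" where
  "tangent_vector At p D \<longleftrightarrow>
     (\<forall>f\<in>smooth_functions At. \<forall>h\<in>smooth_functions At. \<forall>c.
        D (\<lambda>q. f q + h q) = D f + D h \<and>
        D (\<lambda>q. c * f q) = c * D f \<and>
        D (\<lambda>q. f q * h q) = f p * D h + h p * D f)"


section \<open>Vector bundles\<close>

text \<open>
  The fibres are subspaces of one vector space \<open>'v\<close>. No topology on \<open>'v\<close> is involved: it
  merely supplies the linear operations of the fibres, and every family of vector spaces can
  be embedded in such a \<open>'v\<close>, for instance in its direct sum. The smooth structure of
  the total space is given by local trivialisations \<open>(U, \<tau>)\<close> onto the model fibre \<open>'f\<close>;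
  \<open>\<tau> p\<close> matters only for \<open>p\<close> in \<open>U\<close>, and there only on the fibre over \<open>p\<close>.
\<close>

record ('m, 'e, 'v, 'f) vbundle =
  atlas :: "('m set \<times> ('m \<Rightarrow> 'e)) set"
  fibre :: "'m \<Rightarrow> 'v set"
  trivs :: "('m set \<times> ('m \<Rightarrow> 'v \<Rightarrow> 'f)) set"

definition linear_iso_on :: "'v::real_vector set \<Rightarrow> ('v \<Rightarrow> 'f::real_vector) \<Rightarrow> bool" where
  "linear_iso_on V h \<longleftrightarrow> bij_betw h V UNIV \<and>
     (\<forall>v\<in>V. \<forall>w\<in>V. \<forall>a b. h (a *\<^sub>R v + b *\<^sub>R w) = a *\<^sub>R h v + b *\<^sub>R h w)"

definition vector_bundle ::
  "('m::{t2_space,second_countable_topology}, 'e::real_normed_vector, 'v::real_vector,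
    'f::real_normed_vector, 'z) vbundle_scheme \<Rightarrow> bool" where
  "vector_bundle A \<longleftrightarrow>
     smooth_manifold (atlas A) \<and>
     finite_dim TYPE('f) \<and>
     (\<forall>p. subspace (fibre A p)) \<and>
     (\<Union>(U, \<tau>)\<in>trivs A. U) = UNIV \<and>
     (\<forall>(U, \<tau>)\<in>trivs A. open U \<and> (\<forall>p\<in>U. linear_iso_on (fibre A p) (\<tau> p))) \<and>
     (\<forall>(U, \<tau>)\<in>trivs A. \<forall>(V, \<sigma>)\<in>trivs A. \<forall>w.
        smooth_map_on (atlas A) (U \<inter> V) (\<lambda>p. \<sigma> p (inv_into (fibre A p) (\<tau> p) w)))"

definition sections ::
  "('m, 'e::real_normed_vector, 'v, 'f::real_normed_vector, 'z) vbundle_scheme \<Rightarrow> ('m \<Rightarrow> 'v) set" where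
  "sections A = {X. (\<forall>p. X p \<in> fibre A p) \<and>
     (\<forall>(U, \<tau>)\<in>trivs A. smooth_map_on (atlas A) U (\<lambda>p. \<tau> p (X p)))}"


section \<open>Skew-symmetric algebroids\<close>

text \<open>
  \<open>anchor A p v f\<close> is the derivative of \<open>f\<close> along the tangent vector at \<open>p\<close> that is the image
  of \<open>v\<close>. The last conjunct of \<open>anchor_map\<close> is smoothness of the bundle homomorphism: every
  local frame field is mapped to a local vector field \<open>W\<close> that is smooth, in the sense that
  \<open>W f\<close> is smooth for all smooth \<open>f\<close>.
\<close>

record ('m, 'e, 'v, 'f) algebroid = "('m, 'e, 'v, 'f) vbundle" +
  anchor :: "'m \<Rightarrow> 'v \<Rightarrow> ('m \<Rightarrow> real) \<Rightarrow> real"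
  bracket :: "('m \<Rightarrow> 'v) \<Rightarrow> ('m \<Rightarrow> 'v) \<Rightarrow> ('m \<Rightarrow> 'v)"

definition anchor_map ::
  "('m, 'e::real_normed_vector, 'v::real_vector, 'f::real_normed_vector) algebroid \<Rightarrow> bool" where
  "anchor_map A \<longleftrightarrow>
     (\<forall>p. \<forall>v\<in>fibre A p. tangent_vector (atlas A) p (anchor A p v)) \<and>
     (\<forall>p. \<forall>v\<in>fibre A p. \<forall>w\<in>fibre A p. \<forall>a b. \<forall>f\<in>smooth_functions (atlas A).
        anchor A p (a *\<^sub>R v + b *\<^sub>R w) f = a * anchor A p v f + b * anchor A p w f) \<and>
     (\<forall>(U, \<tau>)\<in>trivs A. \<forall>w. \<forall>f\<in>smooth_functions (atlas A).
        smooth_map_on (atlas A) U (\<lambda>p. anchor A p (inv_into (fibre A p) (\<tau> p) w) f))"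

definition deriv_along ::
  "('m, 'e, 'v, 'f) algebroid \<Rightarrow> ('m \<Rightarrow> 'v) \<Rightarrow> ('m \<Rightarrow> real) \<Rightarrow> ('m \<Rightarrow> real)" where
  "deriv_along A X f = (\<lambda>p. anchor A p (X p) f)"

definition skew_symmetric_algebroid ::
  "('m::{t2_space,second_countable_topology}, 'e::real_normed_vector, 'v::real_vector,
    'f::real_normed_vector) algebroid \<Rightarrow> bool" where
  "skew_symmetric_algebroid A \<longleftrightarrow>
     vector_bundle A \<and> anchor_map A \<and>
     (\<forall>X\<in>sections A. \<forall>Y\<in>sections A. bracket A X Y \<in> sections A) \<and>
     (\<forall>X\<in>sections A. \<forall>Y\<in>sections A. \<forall>Z\<in>sections A. \<forall>a b.
        bracket A (\<lambda>p. a *\<^sub>R X p + b *\<^sub>R Y p) Z =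
          (\<lambda>p. a *\<^sub>R bracket A X Z p + b *\<^sub>R bracket A Y Z p) \<and>
        bracket A Z (\<lambda>p. a *\<^sub>R X p + b *\<^sub>R Y p) =
          (\<lambda>p. a *\<^sub>R bracket A Z X p + b *\<^sub>R bracket A Z Y p)) \<and>
     (\<forall>X\<in>sections A. \<forall>Y\<in>sections A. bracket A X Y = (\<lambda>p. - bracket A Y X p)) \<and>
     (\<forall>X\<in>sections A. \<forall>Y\<in>sections A. \<forall>f\<in>smooth_functions (atlas A).
        bracket A X (\<lambda>p. f p *\<^sub>R Y p) =
          (\<lambda>p. f p *\<^sub>R bracket A X Y p + deriv_along A X f p *\<^sub>R Y p))"


section \<open>Connections and tensors\<close>

definition algebroid_connection ::
  "('m, 'e::real_normed_vector, 'v::real_vector, 'f::real_normed_vector) algebroid \<Rightarrow>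
     (('m \<Rightarrow> 'v) \<Rightarrow> ('m \<Rightarrow> 'v) \<Rightarrow> ('m \<Rightarrow> 'v)) \<Rightarrow> bool" where
  "algebroid_connection A nab \<longleftrightarrow>
     (\<forall>X\<in>sections A. \<forall>Y\<in>sections A. nab X Y \<in> sections A) \<and>
     (\<forall>X\<in>sections A. \<forall>Y\<in>sections A. \<forall>Z\<in>sections A. \<forall>a b.
        nab (\<lambda>p. a *\<^sub>R X p + b *\<^sub>R Y p) Z = (\<lambda>p. a *\<^sub>R nab X Z p + b *\<^sub>R nab Y Z p) \<and>
        nab Z (\<lambda>p. a *\<^sub>R X p + b *\<^sub>R Y p) = (\<lambda>p. a *\<^sub>R nab Z X p + b *\<^sub>R nab Z Y p)) \<and>
     (\<forall>X\<in>sections A. \<forall>Y\<in>sections A. \<forall>f\<in>smooth_functions (atlas A).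
        nab (\<lambda>p. f p *\<^sub>R X p) Y = (\<lambda>p. f p *\<^sub>R nab X Y p) \<and>
        nab X (\<lambda>p. f p *\<^sub>R Y p) =
          (\<lambda>p. f p *\<^sub>R nab X Y p + deriv_along A X f p *\<^sub>R Y p))"

definition torsion ::
  "('m, 'e, 'v::real_vector, 'f) algebroid \<Rightarrow> (('m \<Rightarrow> 'v) \<Rightarrow> ('m \<Rightarrow> 'v) \<Rightarrow> ('m \<Rightarrow> 'v)) \<Rightarrow>
     ('m \<Rightarrow> 'v) \<Rightarrow> ('m \<Rightarrow> 'v) \<Rightarrow> ('m \<Rightarrow> 'v)" where
  "torsion A nab X Y = (\<lambda>p. nab X Y p - nab Y X p - bracket A X Y p)"

text \<open>
  A covariant \<open>k\<close>-tensor field is represented by its action on lists of \<open>k\<close> sections, a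
  \<open>k\<close>-linear map over the ring of smooth functions with smooth values.
\<close>

type_synonym ('m, 'v) tensor = "('m \<Rightarrow> 'v) list \<Rightarrow> ('m \<Rightarrow> real)"

definition covariant_tensors ::
  "('m, 'e::real_normed_vector, 'v::real_vector, 'f::real_normed_vector) algebroid \<Rightarrow> nat \<Rightarrow>
     ('m, 'v) tensor set" where
  "covariant_tensors A k = {\<zeta>. \<forall>Xs. length Xs = k \<and> set Xs \<subseteq> sections A \<longrightarrow>
     \<zeta> Xs \<in> smooth_functions (atlas A) \<and>
     (\<forall>i<k. \<forall>Y\<in>sections A. \<forall>f\<in>smooth_functions (atlas A).
        \<zeta> (Xs[i := (\<lambda>p. f p *\<^sub>R (Xs ! i) p + Y p)]) = (\<lambda>p. f p * \<zeta> Xs p + \<zeta> (Xs[i := Y]) p))}"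

definition alternating_forms ::
  "('m, 'e::real_normed_vector, 'v::real_vector, 'f::real_normed_vector) algebroid \<Rightarrow> nat \<Rightarrow>
     ('m, 'v) tensor set" where
  "alternating_forms A k = {\<zeta> \<in> covariant_tensors A k.
     \<forall>Xs. length Xs = k \<and> set Xs \<subseteq> sections A \<longrightarrow>
       (\<forall>i<k. \<forall>j<k. i \<noteq> j \<longrightarrow> \<zeta> (Xs[i := Xs ! j, j := Xs ! i]) = (\<lambda>p. - \<zeta> Xs p))}"

definition cov_deriv ::
  "('m, 'e, 'v, 'f) algebroid \<Rightarrow> (('m \<Rightarrow> 'v) \<Rightarrow> ('m \<Rightarrow> 'v) \<Rightarrow> ('m \<Rightarrow> 'v)) \<Rightarrow>
     ('m \<Rightarrow> 'v) \<Rightarrow> ('m, 'v) tensor \<Rightarrow> ('m, 'v) tensor" where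
  "cov_deriv A nab X \<zeta> Xs = (\<lambda>p. deriv_along A X (\<zeta> Xs) p -
     (\<Sum>j<length Xs. \<zeta> (Xs[j := nab X (Xs ! j)]) p))"

definition total_cov_deriv ::
  "('m, 'e, 'v, 'f) algebroid \<Rightarrow> (('m \<Rightarrow> 'v) \<Rightarrow> ('m \<Rightarrow> 'v) \<Rightarrow> ('m \<Rightarrow> 'v)) \<Rightarrow>
     ('m, 'v) tensor \<Rightarrow> ('m, 'v) tensor" where
  "total_cov_deriv A nab \<zeta> Xs = cov_deriv A nab (hd Xs) \<zeta> (tl Xs)"

definition sym_cov_deriv ::
  "('m, 'e, 'v, 'f) algebroid \<Rightarrow> (('m \<Rightarrow> 'v) \<Rightarrow> ('m \<Rightarrow> 'v) \<Rightarrow> ('m \<Rightarrow> 'v)) \<Rightarrow>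
     ('m, 'v) tensor \<Rightarrow> ('m, 'v) tensor" where
  "sym_cov_deriv A nab \<eta> Xs = (\<lambda>p. \<Sum>j<length Xs.
     cov_deriv A nab (Xs ! j) \<eta> (take j Xs @ drop (Suc j) Xs) p)"


section \<open>Metrics\<close>

definition pseudo_riemannian_metric ::
  "('m, 'e::real_normed_vector, 'v::real_vector, 'f::real_normed_vector) algebroid \<Rightarrow>
     ('m \<Rightarrow> 'v \<Rightarrow> 'v \<Rightarrow> real) \<Rightarrow> bool" where
  "pseudo_riemannian_metric A g \<longleftrightarrow>
     (\<forall>p. \<forall>u\<in>fibre A p. \<forall>v\<in>fibre A p. g p u v = g p v u) \<and>
     (\<forall>p. \<forall>u\<in>fibre A p. \<forall>v\<in>fibre A p. \<forall>w\<in>fibre A p. \<forall>a b.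
        g p (a *\<^sub>R u + b *\<^sub>R v) w = a * g p u w + b * g p v w) \<and>
     (\<forall>(U, \<tau>)\<in>trivs A. \<forall>v w. smooth_map_on (atlas A) U
        (\<lambda>p. g p (inv_into (fibre A p) (\<tau> p) v) (inv_into (fibre A p) (\<tau> p) w))) \<and>
     (\<forall>p. \<forall>v\<in>fibre A p. (\<forall>w\<in>fibre A p. g p v w = 0) \<longrightarrow> v = 0)"

definition metric_apply ::
  "('m \<Rightarrow> 'v \<Rightarrow> 'v \<Rightarrow> real) \<Rightarrow> ('m \<Rightarrow> 'v) \<Rightarrow> ('m \<Rightarrow> 'v) \<Rightarrow> ('m \<Rightarrow> real)" where
  "metric_apply g X Y = (\<lambda>p. g p (X p) (Y p))"

definition metric_tensor :: "('m \<Rightarrow> 'v \<Rightarrow> 'v \<Rightarrow> real) \<Rightarrow> ('m, 'v) tensor" where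
  "metric_tensor g Xs = metric_apply g (Xs ! 0) (Xs ! 1)"

definition torsion_tensor ::
  "('m, 'e, 'v::real_vector, 'f) algebroid \<Rightarrow> ('m \<Rightarrow> 'v \<Rightarrow> 'v \<Rightarrow> real) \<Rightarrow>
     (('m \<Rightarrow> 'v) \<Rightarrow> ('m \<Rightarrow> 'v) \<Rightarrow> ('m \<Rightarrow> 'v)) \<Rightarrow> ('m, 'v) tensor" where
  "torsion_tensor A g nab Xs = metric_apply g (torsion A nab (Xs ! 0) (Xs ! 1)) (Xs ! 2)"

definition totally_skew_torsion ::
  "('m, 'e::real_normed_vector, 'v::real_vector, 'f::real_normed_vector) algebroid \<Rightarrow>
     ('m \<Rightarrow> 'v \<Rightarrow> 'v \<Rightarrow> real) \<Rightarrow> (('m \<Rightarrow> 'v) \<Rightarrow> ('m \<Rightarrow> 'v) \<Rightarrow> ('m \<Rightarrow> 'v)) \<Rightarrow> bool" where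
  "totally_skew_torsion A g nab \<longleftrightarrow> torsion_tensor A g nab \<in> alternating_forms A 3"

definition metric_compatible ::
  "('m, 'e::real_normed_vector, 'v, 'f::real_normed_vector) algebroid \<Rightarrow>
     ('m \<Rightarrow> 'v \<Rightarrow> 'v \<Rightarrow> real) \<Rightarrow> (('m \<Rightarrow> 'v) \<Rightarrow> ('m \<Rightarrow> 'v) \<Rightarrow> ('m \<Rightarrow> 'v)) \<Rightarrow> bool" where
  "metric_compatible A g nab \<longleftrightarrow>
     (\<forall>X\<in>sections A. \<forall>Y\<in>sections A. \<forall>Z\<in>sections A.
        total_cov_deriv A nab (metric_tensor g) [X, Y, Z] = (\<lambda>p. 0))"

text \<open>
  Sections of the dual bundle are likewise represented by their action on sections, so that
  \<open>flat\<close>, \<open>d_alt\<close> and \<open>lie_alt\<close> take values in maps from sections to functions, and \<open>sharp\<close>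
  assigns to such a map the section of \<open>A\<close> representing it with respect to \<open>g\<close>.
\<close>

type_synonym ('m, 'v) oneform = "('m \<Rightarrow> 'v) \<Rightarrow> ('m \<Rightarrow> real)"

definition flat :: "('m \<Rightarrow> 'v \<Rightarrow> 'v \<Rightarrow> real) \<Rightarrow> ('m \<Rightarrow> 'v) \<Rightarrow> ('m, 'v) oneform" where
  "flat g X = (\<lambda>Y. metric_apply g X Y)"

definition sharp ::
  "('m, 'e::real_normed_vector, 'v, 'f::real_normed_vector) algebroid \<Rightarrow>
     ('m \<Rightarrow> 'v \<Rightarrow> 'v \<Rightarrow> real) \<Rightarrow> ('m, 'v) oneform \<Rightarrow> ('m \<Rightarrow> 'v)" where
  "sharp A g \<omega> = (THE S. S \<in> sections A \<and> (\<forall>Y\<in>sections A. metric_apply g S Y = \<omega> Y))"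

definition d_alt :: "('m, 'e, 'v, 'f) algebroid \<Rightarrow> ('m \<Rightarrow> real) \<Rightarrow> ('m, 'v) oneform" where
  "d_alt A f = (\<lambda>X. deriv_along A X f)"

definition lie_alt ::
  "('m, 'e, 'v, 'f) algebroid \<Rightarrow> ('m \<Rightarrow> 'v) \<Rightarrow> ('m, 'v) oneform \<Rightarrow> ('m, 'v) oneform" where
  "lie_alt A X \<omega> = (\<lambda>Y p. deriv_along A X (\<omega> Y) p - \<omega> (bracket A X Y) p)"

end

theory Submission
  imports Defs "Jordan_Normal_Form.Determinant"
begin

text \<open>
  Let \<open>\<omega>(Z) = (\<L>\<^sub>X X\<^sup>\<flat>)(Z) - 1/2 (d g(X,X))(Z) = X g(X,Z) - g(X,[X,Z]) - 1/2 Z g(X,X)\<close>,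
  where \<open>X f\<close> is the derivative of \<open>f\<close> along the image of \<open>X\<close> under the anchor. The formula with
  \<open>\<omega>(Z)\<close> in place of \<open>g(\<sharp>\<omega>, Z)\<close> is a rearrangement
  (\<open>connection_diagonal_formula\<close>): expanding \<open>(\<nabla>\<^sub>X g)(X,Z)\<close> expresses \<open>g(\<nabla>\<^sub>X X, Z)\<close> through
  \<open>g(X, \<nabla>\<^sub>X Z)\<close>, the torsion trades \<open>\<nabla>\<^sub>X Z\<close> for \<open>\<nabla>\<^sub>Z X + [X,Z]\<close>, and expanding
  \<open>(\<nabla>\<^sub>Z g)(X,X)\<close> turns \<open>g(X, \<nabla>\<^sub>Z X)\<close> into \<open>1/2 Z g(X,X)\<close>; the covariant derivatives of
  \<open>g\<close> that arise on the way are the correction terms. If \<open>\<nabla>g = 0\<close> and the torsion is totally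
  skew, then these terms and the torsion term vanish, since \<open>T\<^sup>g(X,Z,X) = 0\<close>, and \<open>\<nabla>\<^sub>X X\<close> is a
  section that represents \<open>\<omega>\<close>.

  The substance is that \<open>\<sharp>\<omega>\<close>, described as the section \<open>S\<close> with \<open>g(S, Y) = \<omega>(Y)\<close> for all sections
  \<open>Y\<close>, exists and is unique, where \<open>\<omega>\<close> is given only by its action on global sections. The form \<open>\<omega>\<close>
  is linear over the smooth functions: the terms \<open>(X f) g(X,Z)\<close> coming from the derivative and
  from the bracket cancel (\<open>sharp_lie_metric_form\<close>). Its values are smooth. Every such form is
  represented by exactly one section (\<open>musical_isomorphism\<close>, \<open>sharp_eqI\<close>), for three reasons.

  \<^item> There are enough global sections. A smooth bump function supported in a trivialising open set
    extends local frames by zero, so that every fibre vector is the value of a section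
    (\<open>section_through\<close>). With the nondegeneracy of \<open>g\<close> this gives uniqueness.

  \<^item> The form is local. With a bump function \<open>\<rho>\<close> and a local frame \<open>e\<^sub>b\<close>, the global identity
    \<open>\<rho>\<^sup>2 Y = \<Sum>\<^sub>b (\<rho> y\<^sub>b)(\<rho> e\<^sub>b)\<close> shows \<open>\<omega>(Y) = \<Sum>\<^sub>b y\<^sub>b w\<^sub>b\<close> with smooth \<open>w\<^sub>b\<close> wherever \<open>\<rho>\<close> is nonzero
    (\<open>oneform_local_expansion\<close>).

  \<^item> The coefficients of the representing section solve the linear system whose matrix is the Gram
    matrix of the frame. By Cramer's rule they are smooth (\<open>cramer_in_function_algebra\<close>,
    \<open>oneform_local_representative\<close>).

  The bump functions need the calculus of iterated directional derivatives on normed spaces spanned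
  by a finite set: coordinates there are bounded (\<open>bounded_linear_representation\<close>) and coordinate
  boxes are compact (\<open>compact_box\<close>), which gives the chain rule (\<open>Ck_on_compose\<close>) and compactly
  supported functions.
\<close>

section \<open>Calculus of iterated directional derivatives\<close>

lemma Ck_on_subset: "Ck_on k S f \<Longrightarrow> T \<subseteq> S \<Longrightarrow> Ck_on k T f"
  by (induction k arbitrary: f) (auto intro: continuous_on_subset)

lemma Ck_on_cong:
  assumes "open S" "\<And>x. x \<in> S \<Longrightarrow> f x = g x" "Ck_on k S f"
  shows "Ck_on k S g"
  using assms(2,3)
proof (induction k arbitrary: f g)
  case 0
  then show ?case by (auto cong: continuous_on_cong)
next
  case (Suc k)
  have der: "(g has_derivative frechet_derivative f (at x)) (at x)" if x: "x \<in> S" for x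
  proof (rule has_derivative_transform_within_open[OF _ assms(1) x Suc.prems(1)])
    show "(f has_derivative frechet_derivative f (at x)) (at x)"
      using Suc.prems(2) x by (simp add: frechet_derivative_works)
  qed
  have eq: "frechet_derivative f (at x) = frechet_derivative g (at x)" if "x \<in> S" for x
    using frechet_derivative_at[OF der[OF that]] .
  show ?case
    using Suc.IH[of "\<lambda>x. frechet_derivative f (at x) v" "\<lambda>x. frechet_derivative g (at x) v" for v]
      Suc.prems(2) der eq
    by (auto simp: differentiable_def)
qed

text \<open>
  Being \<open>C\<close>-\<open>k\<close> on the whole of \<open>S\<close> is a pointwise requirement on germs, so it may be checked on
  neighbourhoods, which need not lie in \<open>S\<close>.
\<close>

lemma Ck_on_locally:
  assumes "\<And>x. x \<in> S \<Longrightarrow> \<exists>T. open T \<and> x \<in> T \<and> Ck_on k T f"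
  shows "Ck_on k S f"
  using assms
proof (induction k arbitrary: f)
  case 0
  show ?case
    unfolding Ck_on.simps
  proof (rule continuous_at_imp_continuous_on, intro ballI)
    fix x assume "x \<in> S"
    then obtain T where "open T" "x \<in> T" "continuous_on T f" using 0 by auto
    then show "isCont f x" using continuous_on_eq_continuous_at by blast
  qed
next
  case (Suc k)
  show ?case
    using Suc.prems by (auto intro!: Suc.IH) (blast | meson)+
qed

lemma Ck_on_SucD: "Ck_on (Suc k) S f \<Longrightarrow> Ck_on k S f"
proof (induction k arbitrary: f)
  case 0
  then show ?case
    by (auto intro!: continuous_at_imp_continuous_on differentiable_imp_continuous_within)
qed auto

text \<open>
  \<open>Ck_on\<close> speaks of \<open>frechet_derivative\<close>; this rule and the elimination rule after it replace that by
  an explicitly given derivative, so that the usual differentiation rules apply.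
\<close>

lemma Ck_on_SucI:
  assumes "open S" "\<And>x. x \<in> S \<Longrightarrow> (f has_derivative D x) (at x)"
    and "\<And>v. Ck_on k S (\<lambda>x. D x v)"
  shows "Ck_on (Suc k) S f"
proof -
  have "D x = frechet_derivative f (at x)" if "x \<in> S" for x
    using frechet_derivative_at[OF assms(2)[OF that]] .
  then have "Ck_on k S (\<lambda>x. frechet_derivative f (at x) v)" for v
    by (intro Ck_on_cong[OF assms(1) _ assms(3)[of v]]) simp
  then show ?thesis using assms(2) by (auto simp: differentiable_def)
qed

lemma Ck_on_SucE:
  assumes "Ck_on (Suc k) S f"
  obtains D where "\<And>x. x \<in> S \<Longrightarrow> (f has_derivative D x) (at x)"
    "\<And>v. Ck_on k S (\<lambda>x. D x v)"
  using that[of "\<lambda>x. frechet_derivative f (at x)"] assms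
  by (auto simp: frechet_derivative_works)

lemma Ck_on_const: "open S \<Longrightarrow> Ck_on k S (\<lambda>x. c)"
proof (induction k arbitrary: c)
  case (Suc k)
  show ?case by (rule Ck_on_SucI[where D="\<lambda>x v. 0"]) (use Suc in auto)
qed auto

lemma Ck_on_add:
  assumes "open S"
  shows "Ck_on k S f \<Longrightarrow> Ck_on k S g \<Longrightarrow> Ck_on k S (\<lambda>x. f x + g x)"
proof (induction k arbitrary: f g)
  case (Suc k)
  obtain F where F: "\<And>x. x \<in> S \<Longrightarrow> (f has_derivative F x) (at x)" "\<And>v. Ck_on k S (\<lambda>x. F x v)"
    using Suc.prems(1) by (rule Ck_on_SucE) blast
  obtain G where G: "\<And>x. x \<in> S \<Longrightarrow> (g has_derivative G x) (at x)" "\<And>v. Ck_on k S (\<lambda>x. G x v)"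
    using Suc.prems(2) by (rule Ck_on_SucE) blast
  show ?case
    by (rule Ck_on_SucI[OF assms, where D="\<lambda>x v. F x v + G x v"])
      (use F G Suc.IH in \<open>auto intro: has_derivative_add\<close>)
qed (auto intro: continuous_on_add)

lemma Ck_on_sum:
  assumes "open S" "\<And>i. i \<in> I \<Longrightarrow> Ck_on k S (f i)"
  shows "Ck_on k S (\<lambda>x. \<Sum>i\<in>I. f i x)"
  using assms by (induction I rule: infinite_finite_induct) (auto intro: Ck_on_const Ck_on_add)

lemma Ck_on_bounded_linear:
  assumes "open S" "bounded_linear h"
  shows "Ck_on k S f \<Longrightarrow> Ck_on k S (\<lambda>x. h (f x))"
proof (induction k arbitrary: f)
  case (Suc k)
  obtain F where F: "\<And>x. x \<in> S \<Longrightarrow> (f has_derivative F x) (at x)" "\<And>v. Ck_on k S (\<lambda>x. F x v)"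
    using Suc.prems(1) by (rule Ck_on_SucE) blast
  show ?case
    by (rule Ck_on_SucI[OF assms(1), where D="\<lambda>x v. h (F x v)"])
      (use F Suc.IH in \<open>auto intro: bounded_linear.has_derivative[OF assms(2)]\<close>)
qed (auto intro: bounded_linear.continuous_on[OF assms(2)])

lemma Ck_on_bounded_bilinear:
  assumes "open S" "bounded_bilinear h"
  shows "Ck_on k S f \<Longrightarrow> Ck_on k S g \<Longrightarrow> Ck_on k S (\<lambda>x. h (f x) (g x))"
proof (induction k arbitrary: f g)
  case (Suc k)
  obtain F where F: "\<And>x. x \<in> S \<Longrightarrow> (f has_derivative F x) (at x)" "\<And>v. Ck_on k S (\<lambda>x. F x v)"
    using Suc.prems(1) by (rule Ck_on_SucE) blast
  obtain G where G: "\<And>x. x \<in> S \<Longrightarrow> (g has_derivative G x) (at x)" "\<And>v. Ck_on k S (\<lambda>x. G x v)"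
    using Suc.prems(2) by (rule Ck_on_SucE) blast
  have "Ck_on k S f" "Ck_on k S g" using Suc.prems Ck_on_SucD by blast+
  then show ?case
    by (intro Ck_on_SucI[OF assms(1), where D="\<lambda>x v. h (f x) (G x v) + h (F x v) (g x)"])
      (use F G Suc.IH assms in \<open>auto intro!: Ck_on_add bounded_bilinear.FDERIV\<close>)
qed (auto intro: bounded_bilinear.continuous_on[OF assms(2)])

lemma Ck_on_inverse: "Ck_on k (- {0}) (inverse :: real \<Rightarrow> real)"
proof (induction k)
  case (Suc k)
  have "Ck_on k (- {0}) (\<lambda>x::real. - (inverse x * v * inverse x))" for v
  proof -
    have "Ck_on k (- {0}) (\<lambda>x::real. inverse x * inverse x)"
      using Ck_on_bounded_bilinear[OF _ bounded_bilinear_mult Suc Suc] by auto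
    then have "Ck_on k (- {0}) (\<lambda>x::real. (- v) * (inverse x * inverse x))"
      by (rule Ck_on_bounded_linear[OF _ bounded_linear_mult_right, rotated]) auto
    then show ?thesis by (simp add: mult_ac)
  qed
  then show ?case
    by (intro Ck_on_SucI[where D="\<lambda>x v. - (inverse x * v * inverse x)"])
      (auto intro!: has_derivative_inverse')
qed (auto intro: continuous_on_inverse)

section \<open>Normed spaces spanned by a finite set\<close>

lemma finite_dim_basis:
  assumes "finite_dim TYPE('a::real_vector)"
  obtains B :: "'a::real_vector set" where "finite B" "independent B" "span B = UNIV"
proof -
  obtain C :: "'a set" where C: "finite C" "span C = UNIV"
    using assms by (auto simp: finite_dim_def)
  obtain B where "B \<subseteq> C" "independent B" "C \<subseteq> span B"
    by (rule maximal_independent_subset)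
  then show ?thesis
    using that[of B] C by (metis finite_subset span_mono span_span top.extremum_uniqueI)
qed

text \<open>
  Add one vector \<open>a\<close> at a time. If \<open>a\<close> has distance \<open>d > 0\<close> from the closed subspace spanned so
  far, then \<open>|t| d \<le> norm (t a + y)\<close>, so in a convergent sequence of vectors \<open>t\<^sub>n a + y\<^sub>n\<close> the
  coefficients \<open>t\<^sub>n\<close> converge too.
\<close>

lemma closed_span_finite:
  fixes C :: "'a::real_normed_vector set"
  assumes "finite C"
  shows "closed (span C)"
  using assms
proof (induction C)
  case empty
  then show ?case by simp
next
  case (insert a C)
  show ?case
  proof (cases "a \<in> span C")
    case True
    then show ?thesis using insert by (simp add: span_redundant)
  next
    case False
    define d where "d = infdist a (span C)"
    have d: "d > 0"
      unfolding d_def using False insert.IH span_zero[of C]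
      by (intro infdist_pos_not_in_closed) auto
    have bound: "\<bar>t\<bar> * d \<le> norm (t *\<^sub>R a + y)" if y: "y \<in> span C" for t y
    proof (cases "t = 0")
      case False
      have "d \<le> dist a (- (1 / t) *\<^sub>R y)"
        unfolding d_def by (intro infdist_le span_scale y)
      also have "\<dots> = norm ((1/t) *\<^sub>R (t *\<^sub>R a + y))"
        using False by (simp add: dist_norm scaleR_add_right)
      also have "\<dots> = norm (t *\<^sub>R a + y) / \<bar>t\<bar>" by simp
      finally show ?thesis using False by (simp add: field_simps)
    qed simp
    show ?thesis
      unfolding closed_sequential_limits
    proof (intro allI impI, elim conjE)
      fix x l assume x: "\<forall>n. x n \<in> span (insert a C)" and lim: "x \<longlonglongrightarrow> l"
      have "\<forall>n. \<exists>t. x n - t *\<^sub>R a \<in> span C" using x by (simp add: span_breakdown_eq)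
      then obtain t where t: "\<And>n. x n - t n *\<^sub>R a \<in> span C" by metis
      have "Cauchy t"
      proof (rule metric_CauchyI)
        fix e :: real assume e: "e > 0"
        have "Cauchy x" using lim LIMSEQ_imp_Cauchy by blast
        then obtain M where M: "\<And>m n. m \<ge> M \<Longrightarrow> n \<ge> M \<Longrightarrow> dist (x m) (x n) < e * d"
          using e d unfolding Cauchy_def by (meson mult_pos_pos)
        show "\<exists>M. \<forall>m\<ge>M. \<forall>n\<ge>M. dist (t m) (t n) < e"
        proof (intro exI[of _ M] allI impI)
          fix m n assume "M \<le> m" "M \<le> n"
          then have "norm (x m - x n) < e * d" using M by (simp add: dist_norm)
          moreover have "\<bar>t m - t n\<bar> * d \<le> norm (x m - x n)"
            using bound[OF span_diff[OF t[of m] t[of n]], of "t m - t n"]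
            by (simp add: algebra_simps)
          ultimately have "\<bar>t m - t n\<bar> * d < e * d" by simp
          then show "dist (t m) (t n) < e" using d by (simp add: dist_norm)
        qed
      qed
      then obtain s where s: "t \<longlonglongrightarrow> s" using Cauchy_convergent convergent_def by blast
      have "(\<lambda>n. x n - t n *\<^sub>R a) \<longlonglongrightarrow> l - s *\<^sub>R a"
        by (intro tendsto_intros lim s)
      then have "l - s *\<^sub>R a \<in> span C"
        by (rule closed_sequentially[OF insert.IH t])
      then show "l \<in> span (insert a C)" by (auto simp: span_breakdown_eq)
    qed
  qed
qed

text \<open>
  The coordinate along \<open>b\<close> is bounded by the reciprocal of the positive distance from \<open>b\<close> to the
  closed span of the other basis vectors.
\<close>

lemma bounded_linear_representation:
  fixes B :: "'a::real_normed_vector set"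
  assumes B: "finite B" "independent B" "span B = UNIV"
  shows "bounded_linear (\<lambda>x. representation B x b)"
proof (cases "b \<in> B")
  case False
  have "representation B x b = 0" for x using False representation_ne_zero by metis
  then show ?thesis by simp
next
  case True
  define d where "d = infdist b (span (B - {b}))"
  have "b \<notin> span (B - {b})" using B(2) True dependent_def by blast
  then have d: "d > 0"
    unfolding d_def using closed_span_finite[of "B - {b}"] B(1) span_zero[of "B - {b}"]
    by (intro infdist_pos_not_in_closed) auto
  have bound: "\<bar>representation B x b\<bar> \<le> norm x * (1 / d)" for x
  proof (cases "representation B x b = 0")
    case False
    define t y where "t = representation B x b" and "y = (\<Sum>c\<in>B-{b}. representation B x c *\<^sub>R c)"
    have "x = (\<Sum>c\<in>B. representation B x c *\<^sub>R c)"
      using B by (simp add: sum_representation_eq)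
    then have x: "x = t *\<^sub>R b + y"
      unfolding t_def y_def by (subst (asm) sum.remove[OF B(1) True])
    have y: "y \<in> span (B - {b})" unfolding y_def by (intro span_sum span_scale span_base)
    have "d \<le> dist b (- (1 / t) *\<^sub>R y)"
      unfolding d_def by (intro infdist_le span_scale y)
    also have "\<dots> = norm ((1/t) *\<^sub>R x)"
      using False unfolding t_def[symmetric] by (subst x) (simp add: dist_norm scaleR_add_right)
    also have "\<dots> = norm x / \<bar>t\<bar>" by simp
    finally show ?thesis using False d unfolding t_def by (simp add: field_simps)
  qed (use d in auto)
  show ?thesis
    by (rule bounded_linear_intro[where K="1/d"])
      (use B bound in \<open>auto simp: representation_add representation_scale\<close>)
qed

text \<open>
  The derivative of the composition in direction \<open>v\<close> is \<open>F (g x) (G x v)\<close>, whose direction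
  argument varies with \<open>x\<close>, whereas \<open>Ck_on\<close> controls derivatives only in constant directions.
  Expanding \<open>G x v\<close> in a basis writes it as a sum of products to which the induction hypothesis
  applies; this is where the finite dimension of the middle space enters.
\<close>

lemma Ck_on_compose:
  fixes f :: "'b::real_normed_vector \<Rightarrow> 'c::real_normed_vector"
    and g :: "'a::real_normed_vector \<Rightarrow> 'b"
  assumes fd: "finite_dim TYPE('b)" and S: "open S" and gST: "g ` S \<subseteq> T"
  shows "Ck_on k T f \<Longrightarrow> Ck_on k S g \<Longrightarrow> Ck_on k S (\<lambda>x. f (g x))"
proof (induction k arbitrary: f)
  case 0
  then show ?case using gST by (auto intro: continuous_on_compose2)
next
  case (Suc k)
  obtain B :: "'b set" where B: "finite B" "independent B" "span B = UNIV"
    using finite_dim_basis[OF fd] .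
  obtain F where F: "\<And>x. x \<in> T \<Longrightarrow> (f has_derivative F x) (at x)" "\<And>v. Ck_on k T (\<lambda>x. F x v)"
    using Suc.prems(1) by (rule Ck_on_SucE) blast
  obtain G where G: "\<And>x. x \<in> S \<Longrightarrow> (g has_derivative G x) (at x)" "\<And>v. Ck_on k S (\<lambda>x. G x v)"
    using Suc.prems(2) by (rule Ck_on_SucE) blast
  have g: "Ck_on k S g" using Suc.prems(2) by (rule Ck_on_SucD)
  have eq: "(\<Sum>b\<in>B. representation B (G x v) b *\<^sub>R F (g x) b) = F (g x) (G x v)" if x: "x \<in> S" for x v
  proof -
    have lin: "linear (F (g x))"
      using F(1) gST x by (meson has_derivative_linear image_subset_iff)
    have "F (g x) (G x v) = F (g x) (\<Sum>b\<in>B. representation B (G x v) b *\<^sub>R b)"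
      using B by (simp add: sum_representation_eq)
    then show ?thesis by (simp add: linear_sum[OF lin] linear_cmul[OF lin])
  qed
  have "Ck_on k S (\<lambda>x. \<Sum>b\<in>B. representation B (G x v) b *\<^sub>R F (g x) b)" for v
    by (intro Ck_on_sum S Ck_on_bounded_bilinear[OF S bounded_bilinear_scaleR] Suc.IH[OF F(2)] g
        Ck_on_bounded_linear[OF S bounded_linear_representation[OF B]] G(2))
  then have der: "Ck_on k S (\<lambda>x. F (g x) (G x v))" for v
    by (rule Ck_on_cong[OF S, rotated]) (rule eq)
  show ?case
  proof (rule Ck_on_SucI[OF S _ der])
    fix x assume x: "x \<in> S"
    show "((\<lambda>x. f (g x)) has_derivative (\<lambda>v. F (g x) (G x v))) (at x)"
      using diff_chain_at[OF G(1)[OF x] F(1)] gST x by (auto simp: o_def)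
  qed
qed

section \<open>Bump functions on the model space\<close>

lemma finite_dim_real: "finite_dim TYPE(real)"
proof -
  have "x \<in> span {1}" for x :: real
    using span_scale[OF span_base[of "1::real" "{1}"], of x] by (simp del: span_singleton)
  then show ?thesis unfolding finite_dim_def by (intro exI[of _ "{1}"]) auto
qed

text \<open>
  \<open>x\<^sup>-\<^sup>n exp(-1/x)\<close> on the positive axis, continued by zero. The powers are included because they
  appear in the derivatives of the case \<open>n = 0\<close>.
\<close>

definition flat_exp :: "nat \<Rightarrow> real \<Rightarrow> real" where
  "flat_exp n x = (if x > 0 then exp (- inverse x) * inverse x ^ n else 0)"

lemma flat_exp_tendsto_0: "(flat_exp n \<longlongrightarrow> 0) (at 0)"
proof -
  have "((\<lambda>x::real. exp (- inverse x) * inverse x ^ n) \<longlongrightarrow> 0) (at_right 0)"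
  proof -
    have "((\<lambda>u::real. u ^ n / exp u) \<longlongrightarrow> 0) at_top" by (rule tendsto_power_div_exp_0)
    moreover have "inverse x ^ n / exp (inverse x) = exp (- inverse x) * inverse x ^ n" for x :: real
      by (simp add: exp_minus divide_inverse)
    ultimately show ?thesis
      using filterlim_compose[OF _ filterlim_inverse_at_top_right, of "\<lambda>u. u ^ n / exp u" "nhds 0"]
      by simp
  qed
  then have "(flat_exp n \<longlongrightarrow> 0) (at_right 0)"
    by (rule Lim_transform_eventually)
      (auto simp: flat_exp_def intro!: eventually_mono[OF eventually_at_right_less[of 0]])
  moreover have "(flat_exp n \<longlongrightarrow> 0) (at_left 0)"
    by (rule Lim_transform_eventually[OF tendsto_const])
      (auto simp: flat_exp_def eventually_at_filter)
  ultimately show ?thesis by (simp add: filterlim_split_at)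
qed

text \<open>
  The family is closed under differentiation up to linear combinations, so smoothness of all members
  follows by induction on the order.
\<close>

lemma flat_exp_has_derivative:
  "(flat_exp n has_real_derivative (flat_exp (n + 2) x - n * flat_exp (n + 1) x)) (at x)"
proof -
  consider "x > 0" | "x < 0" | "x = 0" by linarith
  then show ?thesis
  proof cases
    case 1
    have "((\<lambda>x. exp (- inverse x) * inverse x ^ n) has_real_derivative
      (flat_exp (n + 2) x - n * flat_exp (n + 1) x)) (at x)"
    proof (cases n)
      case 0
      then show ?thesis using 1
        by (auto intro!: derivative_eq_intros simp: flat_exp_def power2_eq_square)
    next
      case (Suc m)
      have "real n * inverse x ^ (n - 1) * inverse x ^ 2 = real n * inverse x ^ (n + 1)"
        using Suc by (simp add: power_add[symmetric])
      then show ?thesis using 1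
        by (auto intro!: derivative_eq_intros simp: flat_exp_def power2_eq_square algebra_simps)
    qed
    then show ?thesis
      by (rule has_field_derivative_transform_within_open[of _ _ _ "{0<..}"])
        (use 1 in \<open>auto simp: flat_exp_def\<close>)
  next
    case 2
    then have "((\<lambda>x. 0) has_real_derivative (flat_exp (n + 2) x - n * flat_exp (n + 1) x)) (at x)"
      by (simp add: flat_exp_def)
    then show ?thesis
      by (rule has_field_derivative_transform_within_open[of _ _ _ "{..<0}"])
        (use 2 in \<open>auto simp: flat_exp_def\<close>)
  next
    case 3
    \<comment> \<open>The difference quotient at 0 is the next member of the family.\<close>
    have "((\<lambda>h. flat_exp n h / h) \<longlongrightarrow> 0) (at 0)"
      by (rule Lim_transform_eventually[OF flat_exp_tendsto_0[of "Suc n"]])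
        (auto simp: flat_exp_def eventually_at field_simps intro!: exI[of _ 1])
    then show ?thesis using 3 by (simp add: DERIV_def flat_exp_def)
  qed
qed

lemma Ck_on_flat_exp: "Ck_on k UNIV (flat_exp n)"
proof (induction k arbitrary: n)
  case 0
  show ?case
    using DERIV_isCont[OF flat_exp_has_derivative] by (simp add: continuous_at_imp_continuous_on)
next
  case (Suc k)
  let ?D = "\<lambda>x. flat_exp (n + 2) x - n * flat_exp (n + 1) x"
  have "Ck_on k UNIV (\<lambda>x. v * flat_exp (n + 2) x + (- (v * real n)) * flat_exp (n + 1) x)" for v
    by (intro Ck_on_add Ck_on_bounded_linear[OF _ bounded_linear_mult_right] Suc) auto
  moreover have "(\<lambda>x. v * flat_exp (n + 2) x + (- (v * real n)) * flat_exp (n + 1) x) =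
      (\<lambda>x. ?D x * v)" for v
    by (simp add: algebra_simps)
  ultimately have "Ck_on k UNIV (\<lambda>x. ?D x * v)" for v
    by metis
  then show ?case
    by (intro Ck_on_SucI[where D="\<lambda>x. (*) (?D x)"])
      (use flat_exp_has_derivative[of n] in \<open>simp_all add: has_field_derivative_def\<close>)
qed

text \<open>
  The local compactness needed for compactly supported functions: the box is built from compact
  intervals, one basis vector at a time, by the continuous maps \<open>(t, x) \<mapsto> t a + x\<close>.
\<close>

lemma compact_box:
  fixes B :: "'a::real_normed_vector set"
  assumes "finite B"
  shows "compact {(\<Sum>b\<in>B. c b *\<^sub>R b) | c. \<forall>b\<in>B. \<bar>c b\<bar> \<le> r}"
  using assms
proof (induction B)
  case (insert a B)
  let ?K = "\<lambda>B. {(\<Sum>b\<in>B. c b *\<^sub>R b) | c::'a \<Rightarrow> real. \<forall>b\<in>B. \<bar>c b\<bar> \<le> r}"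
  have "?K (insert a B) = (\<lambda>(t, x). t *\<^sub>R a + x) ` ({-r..r} \<times> ?K B)"
  proof (intro equalityI subsetI)
    fix y assume "y \<in> ?K (insert a B)"
    then obtain c where c: "\<forall>b\<in>insert a B. \<bar>c b\<bar> \<le> r" "y = (\<Sum>b\<in>insert a B. c b *\<^sub>R b)" by blast
    then show "y \<in> (\<lambda>(t, x). t *\<^sub>R a + x) ` ({-r..r} \<times> ?K B)"
      using insert.hyps by (intro image_eqI[of _ _ "(c a, \<Sum>b\<in>B. c b *\<^sub>R b)"]) (auto simp: abs_le_iff)
  next
    fix y assume "y \<in> (\<lambda>(t, x). t *\<^sub>R a + x) ` ({-r..r} \<times> ?K B)"
    then obtain t c where t: "\<bar>t\<bar> \<le> r" and c: "\<forall>b\<in>B. \<bar>c b\<bar> \<le> r"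
      and y: "y = t *\<^sub>R a + (\<Sum>b\<in>B. c b *\<^sub>R b)" by (force simp: abs_le_iff)
    have "(\<Sum>b\<in>B. c b *\<^sub>R b) = (\<Sum>b\<in>B. (c(a := t)) b *\<^sub>R b)"
      using insert.hyps by (intro sum.cong) auto
    then have "y = (\<Sum>b\<in>insert a B. (c(a := t)) b *\<^sub>R b)" using y insert.hyps by simp
    then show "y \<in> ?K (insert a B)" using t c by (intro CollectI exI[of _ "c(a := t)"]) auto
  qed
  moreover have "compact ((\<lambda>(t, x). t *\<^sub>R a + x) ` ({-r..r} \<times> ?K B))"
    by (intro compact_continuous_image compact_Times insert.IH)
      (auto simp: case_prod_beta intro!: continuous_intros)
  ultimately show ?case by simp
qed simp

text \<open>
  In coordinates about \<open>x0\<close> take \<open>flat_exp 0 (r\<^sup>2 - |x - x0|\<^sup>2)\<close>. It vanishes outside the coordinate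
  box of size \<open>r\<close>, which is compact and lies in the given neighbourhood once \<open>r\<close> is small.
\<close>

lemma smooth_bump:
  fixes x0 :: "'e::real_normed_vector"
  assumes fd: "finite_dim TYPE('e)" and W: "open W" "x0 \<in> W"
  obtains h K where "smooth_on UNIV (h :: 'e \<Rightarrow> real)" "h x0 \<noteq> 0" "compact K" "K \<subseteq> W"
    "\<And>x. x \<notin> K \<Longrightarrow> h x = 0"
proof -
  obtain B :: "'e set" where B: "finite B" "independent B" "span B = UNIV"
    using finite_dim_basis[OF fd] .
  obtain e where e: "e > 0" "ball x0 e \<subseteq> W" using W open_contains_ball by metis
  \<comment> \<open>The summand 1 keeps \<open>M\<close> positive when the basis is empty.\<close>
  define M where "M = (\<Sum>b\<in>B. norm b) + 1"
  have M: "M > 0" unfolding M_def by (simp add: add_nonneg_pos sum_nonneg)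
  define r where "r = e / (2 * M)"
  have r: "r > 0" unfolding r_def using e M by simp
  define K0 where "K0 = {(\<Sum>b\<in>B. c b *\<^sub>R b) | c. \<forall>b\<in>B. \<bar>c b\<bar> \<le> r}"
  define K where "K = (+) x0 ` K0"
  define q where "q x = (\<Sum>b\<in>B. (representation B (x - x0) b)\<^sup>2)" for x
  define h where "h x = flat_exp 0 (r\<^sup>2 - q x)" for x
  have cK: "compact K"
    unfolding K_def K0_def by (intro compact_translation compact_box B)
  have "norm y < e" if y: "y \<in> K0" for y
  proof -
    obtain c where c: "\<forall>b\<in>B. \<bar>c b\<bar> \<le> r" and y: "y = (\<Sum>b\<in>B. c b *\<^sub>R b)"
      using y unfolding K0_def by blast
    have "norm y \<le> (\<Sum>b\<in>B. r * norm b)"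
      unfolding y using c by (intro sum_norm_le) (auto intro: mult_right_mono)
    also have "\<dots> \<le> r * M" using r by (simp add: M_def sum_distrib_left algebra_simps)
    also have "\<dots> < e" using M e by (simp add: r_def)
    finally show ?thesis .
  qed
  then have "K \<subseteq> W" using e(2) unfolding K_def by (force simp: dist_norm)
  moreover have "h x = 0" if x: "x \<notin> K" for x
  proof -
    have "x = x0 + (\<Sum>b\<in>B. representation B (x - x0) b *\<^sub>R b)"
      using B by (simp add: sum_representation_eq)
    then have "(\<Sum>b\<in>B. representation B (x - x0) b *\<^sub>R b) \<notin> K0" using x unfolding K_def by blast
    then obtain b where b: "b \<in> B" "\<bar>representation B (x - x0) b\<bar> > r"
      unfolding K0_def using not_le by blast
    have "r\<^sup>2 \<le> (representation B (x - x0) b)\<^sup>2"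
      using b r by (metis abs_ge_self abs_of_pos less_imp_le order.trans power2_abs power_mono)
    also have "\<dots> \<le> q x" unfolding q_def by (rule member_le_sum) (use b B in auto)
    finally show ?thesis by (simp add: h_def flat_exp_def)
  qed
  moreover have "h x0 \<noteq> 0" using r by (simp add: h_def q_def flat_exp_def representation_zero)
  moreover have "smooth_on UNIV h"
    unfolding smooth_on_def
  proof
    fix k
    have id: "Ck_on j UNIV (\<lambda>x::'e. x)" for j
    proof (cases j)
      case (Suc i)
      then show ?thesis
        by (auto intro!: Ck_on_SucI[where D="\<lambda>x v. v"] Ck_on_const)
    qed auto
    have sh: "Ck_on k UNIV (\<lambda>x. x - x0)"
      using Ck_on_add[OF open_UNIV id Ck_on_const[OF open_UNIV, of k "- x0"]] by simp
    have rep: "Ck_on k UNIV (\<lambda>x. representation B (x - x0) b)" for b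
      by (intro Ck_on_bounded_linear[OF _ bounded_linear_representation[OF B]] sh) auto
    have "Ck_on k UNIV (\<lambda>x. r\<^sup>2 + (\<Sum>b\<in>B. (- 1) * (representation B (x - x0) b * representation B (x - x0) b)))"
      by (intro Ck_on_add Ck_on_const Ck_on_sum Ck_on_bounded_linear[OF _ bounded_linear_mult_right]
          Ck_on_bounded_bilinear[OF _ bounded_bilinear_mult] rep) auto
    then have "Ck_on k UNIV (\<lambda>x. r\<^sup>2 - q x)"
      by (simp add: q_def power2_eq_square sum_negf)
    then show "Ck_on k UNIV h"
      unfolding h_def by (intro Ck_on_compose[OF finite_dim_real open_UNIV _ Ck_on_flat_exp]) auto
  qed
  ultimately show ?thesis using that cK by blast
qed

section \<open>Smooth maps on manifolds\<close>

lemma smooth_map_on_iff_Ck_on: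
  "smooth_map_on At W f \<longleftrightarrow>
     (\<forall>U \<phi> k. (U, \<phi>) \<in> At \<longrightarrow> Ck_on k (\<phi> ` (U \<inter> W)) (\<lambda>x. f (inv_into U \<phi> x)))"
  by (auto simp: smooth_map_on_def smooth_on_def o_def)

lemma chart_image_open:
  assumes "smooth_manifold At" "(U, \<phi>) \<in> At" "open W"
  shows "open (\<phi> ` (U \<inter> W))"
proof -
  have h: "homeomorphism U (\<phi> ` U) \<phi> (inv_into U \<phi>)" and o: "open (\<phi> ` U)"
    using assms unfolding smooth_manifold_def by blast+
  have "openin (top_of_set U) (U \<inter> W)" using assms(3) by auto
  from homeomorphism_imp_open_map[OF h this] show ?thesis
    using o openin_open_trans by blast
qed

lemma chart_inverse:
  assumes "smooth_manifold At" "(U, \<phi>) \<in> At" "p \<in> U"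
  shows "inv_into U \<phi> (\<phi> p) = p"
proof -
  have "homeomorphism U (\<phi> ` U) \<phi> (inv_into U \<phi>)"
    using assms unfolding smooth_manifold_def by blast
  then show ?thesis using assms(3) homeomorphism_apply1 by metis
qed

lemma chart_at:
  assumes "smooth_manifold At"
  obtains U \<phi> where "(U, \<phi>) \<in> At" "p \<in> U" "open U"
proof -
  have cov: "(\<Union>(U, \<phi>)\<in>At. U) = UNIV" and op: "\<forall>(U, \<phi>)\<in>At. open U"
    using assms unfolding smooth_manifold_def by (elim conjE; auto)+
  have "p \<in> (\<Union>(U, \<phi>)\<in>At. U)" unfolding cov by simp
  then obtain U \<phi> where "(U, \<phi>) \<in> At" "p \<in> U" by auto
  then show ?thesis using that op by auto
qed

lemma smooth_map_on_subset: "smooth_map_on At W f \<Longrightarrow> V \<subseteq> W \<Longrightarrow> smooth_map_on At V f"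
  unfolding smooth_map_on_iff_Ck_on by (meson Ck_on_subset Int_mono image_mono order.refl)

lemma smooth_map_on_cong:
  assumes M: "smooth_manifold At" and W: "open W"
    and eq: "\<And>p. p \<in> W \<Longrightarrow> f p = g p" and f: "smooth_map_on At W f"
  shows "smooth_map_on At W g"
  unfolding smooth_map_on_iff_Ck_on
proof (intro allI impI)
  fix U \<phi> k assume U: "(U, \<phi>) \<in> At"
  show "Ck_on k (\<phi> ` (U \<inter> W)) (\<lambda>x. g (inv_into U \<phi> x))"
  proof (rule Ck_on_cong[OF chart_image_open[OF M U W]])
    show "Ck_on k (\<phi> ` (U \<inter> W)) (\<lambda>x. f (inv_into U \<phi> x))"
      using f U by (auto simp: smooth_map_on_iff_Ck_on)
  qed (auto simp: chart_inverse[OF M U] eq)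
qed

lemma smooth_map_on_locally:
  assumes M: "smooth_manifold At"
    and loc: "\<And>p. p \<in> W \<Longrightarrow> \<exists>V. open V \<and> p \<in> V \<and> smooth_map_on At V f"
  shows "smooth_map_on At W f"
  unfolding smooth_map_on_iff_Ck_on
proof (intro allI impI, rule Ck_on_locally)
  fix U \<phi> k x assume U: "(U, \<phi>) \<in> At" and "x \<in> \<phi> ` (U \<inter> W)"
  then obtain p where p: "x = \<phi> p" "p \<in> U" "p \<in> W" by blast
  obtain V where V: "open V" "p \<in> V" "smooth_map_on At V f" using loc p by blast
  show "\<exists>T. open T \<and> x \<in> T \<and> Ck_on k T (\<lambda>x. f (inv_into U \<phi> x))"
    by (rule exI[of _ "\<phi> ` (U \<inter> V)"])
      (use chart_image_open[OF M U V(1)] U V p in \<open>auto simp: smooth_map_on_iff_Ck_on\<close>)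
qed

lemma smooth_map_on_const:
  "smooth_manifold At \<Longrightarrow> open W \<Longrightarrow> smooth_map_on At W (\<lambda>p. c)"
  by (auto simp: smooth_map_on_iff_Ck_on intro: Ck_on_const chart_image_open)

lemma smooth_map_on_sum:
  "smooth_manifold At \<Longrightarrow> open W \<Longrightarrow> (\<And>i. i \<in> I \<Longrightarrow> smooth_map_on At W (f i)) \<Longrightarrow>
    smooth_map_on At W (\<lambda>p. \<Sum>i\<in>I. f i p)"
  unfolding smooth_map_on_iff_Ck_on by (auto intro: Ck_on_sum chart_image_open)

lemma smooth_map_on_add:
  "smooth_manifold At \<Longrightarrow> open W \<Longrightarrow> smooth_map_on At W f \<Longrightarrow> smooth_map_on At W g \<Longrightarrow>
    smooth_map_on At W (\<lambda>p. f p + g p)"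
  unfolding smooth_map_on_iff_Ck_on by (auto intro: Ck_on_add chart_image_open)

lemma smooth_map_on_bounded_linear:
  "smooth_manifold At \<Longrightarrow> open W \<Longrightarrow> bounded_linear h \<Longrightarrow> smooth_map_on At W f \<Longrightarrow>
    smooth_map_on At W (\<lambda>p. h (f p))"
  unfolding smooth_map_on_iff_Ck_on by (auto intro: Ck_on_bounded_linear chart_image_open)

lemma smooth_map_on_scaleR:
  "smooth_manifold At \<Longrightarrow> open W \<Longrightarrow> smooth_map_on At W f \<Longrightarrow> smooth_map_on At W g \<Longrightarrow>
    smooth_map_on At W (\<lambda>p. f p *\<^sub>R g p)"
  unfolding smooth_map_on_iff_Ck_on
  by (auto intro: Ck_on_bounded_bilinear[OF _ bounded_bilinear_scaleR] chart_image_open)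

lemma smooth_map_on_mult:
  fixes f g :: "_ \<Rightarrow> real"
  shows "smooth_manifold At \<Longrightarrow> open W \<Longrightarrow> smooth_map_on At W f \<Longrightarrow> smooth_map_on At W g \<Longrightarrow>
    smooth_map_on At W (\<lambda>p. f p * g p)"
  using smooth_map_on_scaleR[of At W f g] by simp

lemma smooth_map_on_inverse:
  fixes f :: "_ \<Rightarrow> real"
  assumes "smooth_manifold At" "open W" "smooth_map_on At W f" "\<And>p. p \<in> W \<Longrightarrow> f p \<noteq> 0"
  shows "smooth_map_on At W (\<lambda>p. inverse (f p))"
  using assms unfolding smooth_map_on_iff_Ck_on
  by (auto intro!: Ck_on_compose[OF finite_dim_real _ _ Ck_on_inverse] chart_image_open
      simp: chart_inverse)

lemma smooth_map_on_continuous: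
  assumes M: "smooth_manifold At" and W: "open W" and f: "smooth_map_on At W f"
  shows "continuous_on W f"
proof (rule continuous_at_imp_continuous_on, intro ballI)
  fix p assume p: "p \<in> W"
  obtain U \<phi> where U: "(U, \<phi>) \<in> At" "p \<in> U" "open U" using chart_at[OF M] .
  have "homeomorphism U (\<phi> ` U) \<phi> (inv_into U \<phi>)"
    using M U(1) unfolding smooth_manifold_def by blast
  then have "continuous_on (U \<inter> W) \<phi>"
    using homeomorphism_cont1 continuous_on_subset by blast
  moreover have "continuous_on (\<phi> ` (U \<inter> W)) (\<lambda>x. f (inv_into U \<phi> x))"
    using f U(1) Ck_on.simps(1) unfolding smooth_map_on_iff_Ck_on by metis
  ultimately have "continuous_on (U \<inter> W) (\<lambda>q. f (inv_into U \<phi> (\<phi> q)))"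
    using continuous_on_compose2 by blast
  then have "continuous_on (U \<inter> W) f"
    by (rule continuous_on_eq) (simp add: chart_inverse[OF M U(1)])
  then show "isCont f p"
    using continuous_on_eq_continuous_at[OF open_Int[OF U(3) W]] U p by blast
qed

lemma smooth_functions_const: "smooth_manifold At \<Longrightarrow> (\<lambda>p. c) \<in> smooth_functions At"
  by (auto simp: smooth_functions_def intro: smooth_map_on_const)

lemma smooth_functions_mult:
  "smooth_manifold At \<Longrightarrow> f \<in> smooth_functions At \<Longrightarrow> h \<in> smooth_functions At \<Longrightarrow>
    (\<lambda>p. f p * h p) \<in> smooth_functions At"
  by (auto simp: smooth_functions_def intro: smooth_map_on_mult)

text \<open>
  Transport a bump function through a chart. In the Hausdorff space its compact support is closed,
  so that the extension by zero is smooth.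
\<close>

lemma smooth_bump_on_manifold:
  assumes M: "smooth_manifold At" and W: "open W" "p0 \<in> W"
  obtains \<rho> K where "\<rho> \<in> smooth_functions At" "\<rho> p0 \<noteq> 0" "closed K" "K \<subseteq> W"
    "\<And>p. p \<notin> K \<Longrightarrow> \<rho> p = 0"
proof -
  obtain U \<phi> where U: "(U, \<phi>) \<in> At" "p0 \<in> U" "open U" using chart_at[OF M] .
  have fd: "finite_dim TYPE('b)" using M unfolding smooth_manifold_def by blast
  have hom: "homeomorphism U (\<phi> ` U) \<phi> (inv_into U \<phi>)"
    using M U(1) unfolding smooth_manifold_def by blast
  obtain h K' where h: "smooth_on UNIV h" "h (\<phi> p0) \<noteq> (0::real)"
    and K': "compact K'" "K' \<subseteq> \<phi> ` (U \<inter> W)" "\<And>x. x \<notin> K' \<Longrightarrow> h x = 0"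
    by (rule smooth_bump[OF fd chart_image_open[OF M U(1) W(1)], of "\<phi> p0"]) (use U W in auto)
  define K where "K = inv_into U \<phi> ` K'"
  define \<rho> where "\<rho> p = (if p \<in> U then h (\<phi> p) else 0)" for p
  have "compact K"
    unfolding K_def using hom K' by (intro compact_continuous_image)
      (auto intro: continuous_on_subset[OF homeomorphism_cont2])
  then have cK: "closed K" by (rule compact_imp_closed)
  have KU: "K \<subseteq> U \<inter> W" unfolding K_def using K'(2) chart_inverse[OF M U(1)] by auto
  have zero: "\<rho> p = 0" if "p \<notin> K" for p
  proof (cases "p \<in> U")
    case True
    then have "\<phi> p \<notin> K'" using that chart_inverse[OF M U(1) True] unfolding K_def by force
    then show ?thesis using K' by (simp add: \<rho>_def)
  qed (simp add: \<rho>_def)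
  have smU: "smooth_map_on At U \<rho>"
    unfolding smooth_map_on_iff_Ck_on
  proof (intro allI impI)
    fix V \<psi> k assume V: "(V, \<psi>) \<in> At"
    have "smooth_on (\<psi> ` (V \<inter> U)) (\<phi> \<circ> inv_into V \<psi>)"
      using M V U(1) unfolding smooth_manifold_def by blast
    then have \<phi>: "Ck_on k (\<psi> ` (V \<inter> U)) (\<lambda>x. \<phi> (inv_into V \<psi> x))"
      by (simp add: smooth_on_def o_def)
    have "Ck_on k UNIV h" using h(1) by (simp add: smooth_on_def)
    then have "Ck_on k (\<psi> ` (V \<inter> U)) (\<lambda>x. h (\<phi> (inv_into V \<psi> x)))"
      by (rule Ck_on_compose[OF fd chart_image_open[OF M V U(3)] subset_UNIV _ \<phi>])
    then show "Ck_on k (\<psi> ` (V \<inter> U)) (\<lambda>x. \<rho> (inv_into V \<psi> x))"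
      by (rule Ck_on_cong[OF chart_image_open[OF M V U(3)], rotated])
        (auto simp: chart_inverse[OF M V] \<rho>_def)
  qed
  have "smooth_map_on At (- K) \<rho>"
    by (rule smooth_map_on_cong[OF M _ _ smooth_map_on_const[OF M, of _ 0]])
      (use cK zero in auto)
  then have "\<exists>V. open V \<and> p \<in> V \<and> smooth_map_on At V \<rho>" for p
    using smU U(3) cK KU by (cases "p \<in> K") (auto intro: exI[of _ U] exI[of _ "- K"])
  then have "smooth_map_on At UNIV \<rho>"
    by (rule smooth_map_on_locally[OF M])
  then show ?thesis
    using that[of \<rho> K] U h cK KU zero by (simp add: smooth_functions_def \<rho>_def)
qed

text \<open>
  Near points outside \<open>U\<close> the product vanishes identically, whatever values \<open>f\<close> takes there.
\<close>

lemma smooth_map_on_extend_by_zero: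
  assumes M: "smooth_manifold At" and W: "open W" and U: "open U"
    and \<rho>: "\<rho> \<in> smooth_functions At" and K: "closed K" "K \<subseteq> U" "\<And>p. p \<notin> K \<Longrightarrow> \<rho> p = 0"
    and f: "smooth_map_on At (W \<inter> U) f"
  shows "smooth_map_on At W (\<lambda>p. \<rho> p *\<^sub>R f p)"
proof -
  have "smooth_map_on At UNIV \<rho>" using \<rho> by (simp add: smooth_functions_def)
  then have 1: "smooth_map_on At (W \<inter> U) (\<lambda>p. \<rho> p *\<^sub>R f p)"
    by (intro smooth_map_on_scaleR M f open_Int W U) (rule smooth_map_on_subset[OF _ subset_UNIV])
  have 2: "smooth_map_on At (W - K) (\<lambda>p. \<rho> p *\<^sub>R f p)"
    by (rule smooth_map_on_cong[OF M _ _ smooth_map_on_const[OF M, of _ 0]])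
      (use W K in auto)
  show ?thesis
  proof (rule smooth_map_on_locally[OF M])
    fix p assume "p \<in> W"
    then show "\<exists>V. open V \<and> p \<in> V \<and> smooth_map_on At V (\<lambda>p. \<rho> p *\<^sub>R f p)"
      using 1 2 W U K
      by (cases "p \<in> K") (auto intro: exI[of _ "W \<inter> U"] exI[of _ "W - K"])
  qed
qed

section \<open>Cramer's rule with smooth coefficients\<close>

text \<open>
  The system with matrix \<open>G\<close> is nonsingular at every point of \<open>N\<close>, so its solution is the adjugate
  matrix applied to \<open>w\<close>, divided by the determinant. Cofactors and determinants are polynomials in
  the entries, hence members of any algebra \<open>F\<close> of functions, and the determinant is inverted by
  assumption. In the application \<open>F\<close> consists of the functions that are smooth on \<open>N\<close>.
\<close>

lemma cramer_in_function_algebra: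
  fixes F :: "('p \<Rightarrow> real) set" and G :: "'b \<Rightarrow> 'b \<Rightarrow> 'p \<Rightarrow> real"
  assumes const: "\<And>c. (\<lambda>p. c) \<in> F"
    and add: "\<And>f h. f \<in> F \<Longrightarrow> h \<in> F \<Longrightarrow> (\<lambda>p. f p + h p) \<in> F"
    and mult: "\<And>f h. f \<in> F \<Longrightarrow> h \<in> F \<Longrightarrow> (\<lambda>p. f p * h p) \<in> F"
    and inv: "\<And>f. f \<in> F \<Longrightarrow> (\<And>p. p \<in> N \<Longrightarrow> f p \<noteq> 0) \<Longrightarrow> (\<lambda>p. inverse (f p)) \<in> F"
    and B: "finite B"
    and G: "\<And>a b. a \<in> B \<Longrightarrow> b \<in> B \<Longrightarrow> G a b \<in> F"
    and w: "\<And>b. b \<in> B \<Longrightarrow> w b \<in> F"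
    and nondeg: "\<And>p c. p \<in> N \<Longrightarrow> \<forall>b\<in>B. (\<Sum>a\<in>B. c a * G a b p) = 0 \<Longrightarrow> \<forall>a\<in>B. c a = 0"
  obtains c where "\<And>b. b \<in> B \<Longrightarrow> c b \<in> F"
    "\<And>p b. p \<in> N \<Longrightarrow> b \<in> B \<Longrightarrow> (\<Sum>a\<in>B. c a p * G a b p) = w b p"
proof -
  have sumF: "(\<lambda>p. \<Sum>i\<in>I. f i p) \<in> F" if "\<And>i. i \<in> I \<Longrightarrow> f i \<in> F" for I :: "'i set" and f
    using that by (induction I rule: infinite_finite_induct) (auto intro: const add)
  have prodF: "(\<lambda>p. \<Prod>i\<in>I. f i p) \<in> F" if "\<And>i. i \<in> I \<Longrightarrow> f i \<in> F" for I :: "'i set" and f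
    using that by (induction I rule: infinite_finite_induct) (auto intro: const mult)
  have detF: "(\<lambda>p. Determinant.det (mat m m (\<lambda>(i, j). H i j p))) \<in> F"
    if H: "\<And>i j. i < m \<Longrightarrow> j < m \<Longrightarrow> H i j \<in> F" for m H
  proof -
    have "Determinant.det (mat m m (\<lambda>(i, j). H i j p)) =
        (\<Sum>\<pi> | \<pi> permutes {0..<m}. signof \<pi> * (\<Prod>i = 0..<m. H i (\<pi> i) p))" for p
      by (subst det_def'[of _ m]) (auto intro!: sum.cong prod.cong simp: permutes_in_image)
    then show ?thesis
      by (simp, intro sumF mult const prodF H) (auto simp: permutes_in_image)
  qed
  define n where "n = card B"
  obtain e where e: "bij_betw e {0..<n} B"
    using ex_bij_betw_nat_finite[OF B] unfolding n_def by blast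
  have eB: "e i \<in> B" if "i < n" for i using e that by (auto simp: bij_betw_def)
  \<comment> \<open>The equations are indexed by the second argument of \<open>G\<close>, hence the transposition.\<close>
  define M where "M p = mat n n (\<lambda>(i, j). G (e j) (e i) p)" for p
  have Mc: "M p \<in> carrier_mat n n" for p by (simp add: M_def)
  have adj: "(\<lambda>p. adj_mat (M p) $$ (i, j)) \<in> F" if ij: "i < n" "j < n" for i j
  proof -
    define H where "H i' j' = G (e (if j' < i then j' else Suc j')) (e (if i' < j then i' else Suc i'))"
      for i' j'
    have "mat_delete (M p) j i = mat (n - 1) (n - 1) (\<lambda>(i', j'). H i' j' p)" for p
      unfolding mat_delete_def H_def M_def by (rule eq_matI) (use ij in auto)
    then have "adj_mat (M p) $$ (i, j) =
        (- 1) ^ (j + i) * Determinant.det (mat (n - 1) (n - 1) (\<lambda>(i', j'). H i' j' p))" for p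
      using ij by (simp add: adj_mat_def cofactor_def M_def)
    then show ?thesis
      by (simp, intro mult const detF) (auto simp: H_def intro!: G eB)
  qed
  have det0: "Determinant.det (M p) \<noteq> 0" if p: "p \<in> N" for p
  proof
    assume "Determinant.det (M p) = 0"
    then obtain v where v: "v \<in> carrier_vec n" "v \<noteq> 0\<^sub>v n" "M p *\<^sub>v v = 0\<^sub>v n"
      using det_0_iff_vec_prod_zero_field[OF Mc] by blast
    define c where "c b = v $ (inv_into {0..<n} e b)" for b
    have ce: "c (e i) = v $ i" if "i < n" for i
      using e that unfolding c_def by (simp add: bij_betw_inv_into_left)
    have "(\<Sum>a\<in>B. c a * G a b p) = 0" if b: "b \<in> B" for b
    proof -
      obtain i where i: "i < n" "b = e i" using e b by (auto simp: bij_betw_def)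
      have "(\<Sum>a\<in>B. c a * G a b p) = (\<Sum>j = 0..<n. c (e j) * G (e j) b p)"
        using sum.reindex_bij_betw[OF e, of "\<lambda>a. c a * G a b p"] by simp
      also have "\<dots> = (M p *\<^sub>v v) $ i"
        using i v(1) by (auto simp: M_def scalar_prod_def ce mult.commute intro!: sum.cong)
      finally show ?thesis using v i by simp
    qed
    then have "\<forall>a\<in>B. c a = 0" using nondeg[OF p] by blast
    then have "v $ i = 0" if "i < n" for i using ce that eB by metis
    then show False using v by auto
  qed
  define u where "u i p = (\<Sum>k = 0..<n. inverse (Determinant.det (M p)) * (adj_mat (M p) $$ (i, k) * w (e k) p))"
    for i p
  have uF: "u i \<in> F" if "i < n" for i
  proof -
    have "(\<lambda>p. inverse (Determinant.det (M p))) \<in> F"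
      by (intro inv det0) (auto simp: M_def intro!: detF G eB)
    then show ?thesis
      unfolding u_def[abs_def] by (intro sumF mult adj w eB) (use that in auto)
  qed
  have main: "(\<Sum>j = 0..<n. u j p * G (e j) (e i) p) = w (e i) p" if p: "p \<in> N" and i: "i < n" for i p
  proof -
    let ?d = "Determinant.det (M p)"
    have col: "(\<Sum>j = 0..<n. G (e j) (e i) p * adj_mat (M p) $$ (j, k)) = (if i = k then ?d else 0)"
      if k: "k < n" for k
    proof -
      have "(M p * adj_mat (M p)) $$ (i, k) = (\<Sum>j = 0..<n. G (e j) (e i) p * adj_mat (M p) $$ (j, k))"
        using i k adj_mat(1)[OF Mc, of p] by (auto simp: M_def scalar_prod_def intro!: sum.cong)
      then show ?thesis using adj_mat(2)[OF Mc, of p] i k by (auto split: if_splits)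
    qed
    have "(\<Sum>j = 0..<n. u j p * G (e j) (e i) p) =
        (\<Sum>j = 0..<n. \<Sum>k = 0..<n. inverse ?d * w (e k) p * (G (e j) (e i) p * adj_mat (M p) $$ (j, k)))"
      by (simp add: u_def sum_distrib_right sum_distrib_left mult_ac)
    also have "\<dots> = (\<Sum>k = 0..<n. inverse ?d * w (e k) p *
        (\<Sum>j = 0..<n. G (e j) (e i) p * adj_mat (M p) $$ (j, k)))"
      by (subst sum.swap) (simp add: sum_distrib_left)
    also have "\<dots> = (\<Sum>k = 0..<n. if i = k then inverse ?d * w (e k) p * ?d else 0)"
      by (intro sum.cong) (auto simp: col)
    also have "\<dots> = w (e i) p" using i det0[OF p] by simp
    finally show ?thesis .
  qed
  define c where "c b = u (inv_into {0..<n} e b)" for b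
  have ce: "c (e i) = u i" if "i < n" for i
    using e that unfolding c_def by (simp add: bij_betw_inv_into_left)
  show ?thesis
  proof
    fix b assume "b \<in> B"
    then obtain i where i: "i < n" "b = e i" using e by (auto simp: bij_betw_def)
    show "c b \<in> F" using i uF ce by simp
  next
    fix p b assume p: "p \<in> N" and "b \<in> B"
    then obtain i where i: "i < n" "b = e i" using e by (auto simp: bij_betw_def)
    have "(\<Sum>a\<in>B. c a p * G a b p) = (\<Sum>j = 0..<n. c (e j) p * G (e j) b p)"
      using sum.reindex_bij_betw[OF e, of "\<lambda>a. c a p * G a b p"] by simp
    also have "\<dots> = (\<Sum>j = 0..<n. u j p * G (e j) b p)" by (simp add: ce)
    finally show "(\<Sum>a\<in>B. c a p * G a b p) = w b p" using main[OF p i(1)] i by simp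
  qed
qed

section \<open>Sections of vector bundles\<close>

text \<open>
  Trivialisations, anchors and metrics are linear only on the fibres, so the general theory of
  linear maps on a vector space does not apply to them.
\<close>

lemma linear_combination_on_subspace:
  fixes L :: "'v::real_vector \<Rightarrow> 'w::real_vector"
  assumes V: "subspace V"
    and L: "\<And>a b v w. v \<in> V \<Longrightarrow> w \<in> V \<Longrightarrow> L (a *\<^sub>R v + b *\<^sub>R w) = a *\<^sub>R L v + b *\<^sub>R L w"
    and v: "\<And>i. i \<in> I \<Longrightarrow> v i \<in> V"
  shows "L (\<Sum>i\<in>I. c i *\<^sub>R v i) = (\<Sum>i\<in>I. c i *\<^sub>R L (v i))"
proof -
  have 0: "L 0 = 0" using L[of 0 0 0 0] subspace_0[OF V] by simp
  show ?thesis
    using v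
  proof (induction I rule: infinite_finite_induct)
    case (insert i I)
    have "(\<Sum>i\<in>I. c i *\<^sub>R v i) \<in> V"
      using insert.prems V by (intro subspace_sum subspace_scale) auto
    then have "L (c i *\<^sub>R v i + 1 *\<^sub>R (\<Sum>i\<in>I. c i *\<^sub>R v i)) =
        c i *\<^sub>R L (v i) + 1 *\<^sub>R L (\<Sum>i\<in>I. c i *\<^sub>R v i)"
      using insert.prems by (intro L) auto
    then show ?case using insert by simp
  qed (use 0 in auto)
qed

abbreviation frame_vector ::
  "('m, 'e, 'v, 'f, 'z) vbundle_scheme \<Rightarrow> ('m \<Rightarrow> 'v \<Rightarrow> 'f) \<Rightarrow> 'm \<Rightarrow> 'f \<Rightarrow> 'v" where
  "frame_vector A \<tau> p w \<equiv> inv_into (fibre A p) (\<tau> p) w"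

context
  fixes A :: "('m::{t2_space,second_countable_topology}, 'e::real_normed_vector, 'v::real_vector,
    'f::real_normed_vector, 'z) vbundle_scheme"
  assumes A: "vector_bundle A"
begin

lemma bundle_manifold: "smooth_manifold (atlas A)"
  using A by (simp add: vector_bundle_def)

lemma bundle_finite_dim: "finite_dim TYPE('f)"
  using A by (simp add: vector_bundle_def)

lemma fibre_subspace: "subspace (fibre A p)"
  using A by (simp add: vector_bundle_def)

lemma triv_at: obtains U \<tau> where "(U, \<tau>) \<in> trivs A" "p \<in> U"
proof -
  have "(\<Union>(U, \<tau>)\<in>trivs A. U) = UNIV" using A by (simp add: vector_bundle_def)
  then have "p \<in> (\<Union>(U, \<tau>)\<in>trivs A. U)" by simp
  then show ?thesis using that by auto
qed

lemma triv_open: "(U, \<tau>) \<in> trivs A \<Longrightarrow> open U"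
  using A unfolding vector_bundle_def by (elim conjE) auto

lemma triv_iso: "(U, \<tau>) \<in> trivs A \<Longrightarrow> p \<in> U \<Longrightarrow> linear_iso_on (fibre A p) (\<tau> p)"
  using A unfolding vector_bundle_def by (elim conjE) auto

lemma frame_vector_smooth:
  "(U, \<tau>) \<in> trivs A \<Longrightarrow> (V, \<sigma>) \<in> trivs A \<Longrightarrow>
    smooth_map_on (atlas A) (U \<inter> V) (\<lambda>p. \<sigma> p (frame_vector A \<tau> p w))"
  using A unfolding vector_bundle_def by (elim conjE) fast

lemma frame_vector_in_fibre: "(U, \<tau>) \<in> trivs A \<Longrightarrow> p \<in> U \<Longrightarrow> frame_vector A \<tau> p w \<in> fibre A p"
  using triv_iso[of U \<tau> p] unfolding linear_iso_on_def bij_betw_def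
  by (metis UNIV_I inv_into_into)

lemma triv_frame_vector: "(U, \<tau>) \<in> trivs A \<Longrightarrow> p \<in> U \<Longrightarrow> \<tau> p (frame_vector A \<tau> p w) = w"
  using triv_iso[of U \<tau> p] unfolding linear_iso_on_def bij_betw_def
  by (metis UNIV_I f_inv_into_f)

lemma triv_linear_combination:
  assumes "(U, \<tau>) \<in> trivs A" "p \<in> U" "\<And>i. i \<in> I \<Longrightarrow> v i \<in> fibre A p"
  shows "\<tau> p (\<Sum>i\<in>I. c i *\<^sub>R v i) = (\<Sum>i\<in>I. c i *\<^sub>R \<tau> p (v i))"
  using triv_iso[OF assms(1,2)] assms(3)
  by (intro linear_combination_on_subspace[OF fibre_subspace]) (auto simp: linear_iso_on_def)

lemma frame_expansion:
  assumes U: "(U, \<tau>) \<in> trivs A" "p \<in> U" and v: "v \<in> fibre A p"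
    and B: "finite B" "independent B" "span B = UNIV"
  shows "v = (\<Sum>b\<in>B. representation B (\<tau> p v) b *\<^sub>R frame_vector A \<tau> p b)"
proof -
  have "\<tau> p (\<Sum>b\<in>B. representation B (\<tau> p v) b *\<^sub>R frame_vector A \<tau> p b) = \<tau> p v"
    using triv_linear_combination[OF U, of B "frame_vector A \<tau> p"] frame_vector_in_fibre[OF U] B
    by (simp add: triv_frame_vector[OF U] sum_representation_eq)
  moreover have "(\<Sum>b\<in>B. representation B (\<tau> p v) b *\<^sub>R frame_vector A \<tau> p b) \<in> fibre A p"
    by (intro subspace_sum subspace_scale fibre_subspace frame_vector_in_fibre[OF U])
  moreover have "inj_on (\<tau> p) (fibre A p)"
    using triv_iso[OF U] by (simp add: linear_iso_on_def bij_betw_def)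
  ultimately show ?thesis using v by (metis inj_onD)
qed

lemma section_in_fibre: "X \<in> sections A \<Longrightarrow> X p \<in> fibre A p"
  by (simp add: sections_def)

lemma section_smooth: "X \<in> sections A \<Longrightarrow> (U, \<tau>) \<in> trivs A \<Longrightarrow> smooth_map_on (atlas A) U (\<lambda>p. \<tau> p (X p))"
  unfolding sections_def by auto

lemma sectionI:
  assumes "\<And>p. X p \<in> fibre A p"
    and "\<And>U \<tau>. (U, \<tau>) \<in> trivs A \<Longrightarrow> smooth_map_on (atlas A) U (\<lambda>p. \<tau> p (X p))"
  shows "X \<in> sections A"
  using assms unfolding sections_def by auto

lemma section_coordinate_smooth:
  assumes "X \<in> sections A" "(U, \<tau>) \<in> trivs A"
    and B: "finite B" "independent B" "span B = UNIV"
  shows "smooth_map_on (atlas A) U (\<lambda>p. representation B (\<tau> p (X p)) b)"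
  by (intro smooth_map_on_bounded_linear[OF bundle_manifold triv_open[OF assms(2)]
        bounded_linear_representation[OF B]] section_smooth assms)

lemma section_linear_combination:
  assumes f: "\<And>i. i \<in> I \<Longrightarrow> f i \<in> smooth_functions (atlas A)"
    and X: "\<And>i. i \<in> I \<Longrightarrow> X i \<in> sections A"
  shows "(\<lambda>p. \<Sum>i\<in>I. f i p *\<^sub>R X i p) \<in> sections A"
proof (rule sectionI)
  show "(\<Sum>i\<in>I. f i p *\<^sub>R X i p) \<in> fibre A p" for p
    using X by (intro subspace_sum subspace_scale fibre_subspace section_in_fibre)
next
  fix U \<tau> assume U: "(U, \<tau>) \<in> trivs A"
  note M = bundle_manifold triv_open[OF U]
  have "smooth_map_on (atlas A) U (\<lambda>p. \<Sum>i\<in>I. f i p *\<^sub>R \<tau> p (X i p))"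
    using f smooth_map_on_subset unfolding smooth_functions_def
    by (intro smooth_map_on_sum smooth_map_on_scaleR M section_smooth X U) blast+
  then show "smooth_map_on (atlas A) U (\<lambda>p. \<tau> p (\<Sum>i\<in>I. f i p *\<^sub>R X i p))"
    by (rule smooth_map_on_cong[OF M, rotated])
      (use X in \<open>simp add: triv_linear_combination[OF U] section_in_fibre\<close>)
qed

lemma section_scale:
  "f \<in> smooth_functions (atlas A) \<Longrightarrow> X \<in> sections A \<Longrightarrow> (\<lambda>p. f p *\<^sub>R X p) \<in> sections A"
  using section_linear_combination[of "{()}" "\<lambda>_. f" "\<lambda>_. X"] by simp

text \<open>
  Expanding the section in the frame reduces smoothness to the frame vectors. Derivatives along
  sections and metric products, one argument at a time, are of this kind.
\<close>

lemma fibrewise_linear_smooth: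
  fixes L :: "'m \<Rightarrow> 'v \<Rightarrow> real"
  assumes U: "(U, \<tau>) \<in> trivs A" and X: "X \<in> sections A"
    and lin: "\<And>p v w a b. p \<in> U \<Longrightarrow> v \<in> fibre A p \<Longrightarrow> w \<in> fibre A p \<Longrightarrow>
      L p (a *\<^sub>R v + b *\<^sub>R w) = a * L p v + b * L p w"
    and sm: "\<And>w. smooth_map_on (atlas A) U (\<lambda>p. L p (frame_vector A \<tau> p w))"
  shows "smooth_map_on (atlas A) U (\<lambda>p. L p (X p))"
proof -
  obtain B :: "'f set" where B: "finite B" "independent B" "span B = UNIV"
    using finite_dim_basis[OF bundle_finite_dim] .
  note M = bundle_manifold triv_open[OF U]
  have "smooth_map_on (atlas A) U
      (\<lambda>p. \<Sum>b\<in>B. representation B (\<tau> p (X p)) b * L p (frame_vector A \<tau> p b))"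
    by (intro smooth_map_on_sum smooth_map_on_mult M sm section_coordinate_smooth X U B)
  then show ?thesis
  proof (rule smooth_map_on_cong[OF M, rotated])
    fix p assume p: "p \<in> U"
    have "L p (X p) = L p (\<Sum>b\<in>B. representation B (\<tau> p (X p)) b *\<^sub>R frame_vector A \<tau> p b)"
      using frame_expansion[OF U p section_in_fibre[OF X] B] by simp
    then show "(\<Sum>b\<in>B. representation B (\<tau> p (X p)) b * L p (frame_vector A \<tau> p b)) = L p (X p)"
      using linear_combination_on_subspace[OF fibre_subspace[of p], of "L p" B
          "frame_vector A \<tau> p" "representation B (\<tau> p (X p))"]
        lin[OF p] frame_vector_in_fibre[OF U p] by simp
  qed
qed

lemma smooth_functionsI:
  assumes "\<And>U \<tau>. (U, \<tau>) \<in> trivs A \<Longrightarrow> smooth_map_on (atlas A) U f"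
  shows "f \<in> smooth_functions (atlas A)"
  unfolding smooth_functions_def mem_Collect_eq
proof (rule smooth_map_on_locally[OF bundle_manifold])
  fix p
  obtain U \<tau> where "(U, \<tau>) \<in> trivs A" "p \<in> U" by (rule triv_at)
  then show "\<exists>V. open V \<and> p \<in> V \<and> smooth_map_on (atlas A) V f"
    using assms triv_open by blast
qed

text \<open>
  These are the global sections from which all others are built locally. Outside \<open>U\<close> the frame vector
  is an arbitrary element of the ambient space, but there the cutoff function is zero.
\<close>

lemma cutoff_frame_section:
  assumes U: "(U, \<tau>) \<in> trivs A"
    and \<rho>: "\<rho> \<in> smooth_functions (atlas A)"
    and K: "closed K" "K \<subseteq> U" "\<And>p. p \<notin> K \<Longrightarrow> \<rho> p = 0"
  shows "(\<lambda>p. \<rho> p *\<^sub>R frame_vector A \<tau> p w) \<in> sections A"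
proof (rule sectionI)
  show fib: "\<rho> p *\<^sub>R frame_vector A \<tau> p w \<in> fibre A p" for p
  proof (cases "p \<in> U")
    case True
    then show ?thesis by (intro subspace_scale fibre_subspace frame_vector_in_fibre[OF U])
  next
    case False
    then have "\<rho> p = 0" using K by blast
    then show ?thesis by (simp add: subspace_0 fibre_subspace)
  qed
  fix V \<sigma> assume V: "(V, \<sigma>) \<in> trivs A"
  note M = bundle_manifold triv_open[OF V]
  have "smooth_map_on (atlas A) V (\<lambda>p. \<rho> p *\<^sub>R \<sigma> p (frame_vector A \<tau> p w))"
    using frame_vector_smooth[OF U V]
    by (intro smooth_map_on_extend_by_zero[OF M triv_open[OF U] \<rho> K]) (auto simp: Int_commute)
  then show "smooth_map_on (atlas A) V (\<lambda>p. \<sigma> p (\<rho> p *\<^sub>R frame_vector A \<tau> p w))"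
  proof (rule smooth_map_on_cong[OF M, rotated])
    fix p assume p: "p \<in> V"
    show "\<rho> p *\<^sub>R \<sigma> p (frame_vector A \<tau> p w) = \<sigma> p (\<rho> p *\<^sub>R frame_vector A \<tau> p w)"
    proof (cases "p \<in> U")
      case True
      then show ?thesis
        using triv_linear_combination[OF V p, of "{()}" "\<lambda>_. frame_vector A \<tau> p w" "\<lambda>_. \<rho> p"]
          frame_vector_in_fibre[OF U True] by simp
    next
      case False
      then have "\<rho> p = 0" using K by blast
      then show ?thesis
        using triv_linear_combination[OF V p, of "{}"] by simp
    qed
  qed
qed

lemma section_through:
  assumes v: "v \<in> fibre A p0"
  obtains Y where "Y \<in> sections A" "Y p0 = v"
proof -
  obtain U \<tau> where U: "(U, \<tau>) \<in> trivs A" "p0 \<in> U" by (rule triv_at)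
  obtain \<rho> K where \<rho>: "\<rho> \<in> smooth_functions (atlas A)" "\<rho> p0 \<noteq> 0"
    and K: "closed K" "K \<subseteq> U" "\<And>p. p \<notin> K \<Longrightarrow> \<rho> p = 0"
    by (rule smooth_bump_on_manifold[OF bundle_manifold triv_open[OF U(1)] U(2)]) blast
  have inv: "frame_vector A \<tau> p0 (\<tau> p0 v) = v"
    using triv_iso[OF U] v by (simp add: linear_iso_on_def bij_betw_def)
  have "(\<lambda>p. (1 / \<rho> p0) *\<^sub>R (\<rho> p *\<^sub>R frame_vector A \<tau> p (\<tau> p0 v))) \<in> sections A"
    by (intro section_scale[of "\<lambda>_. 1 / \<rho> p0"] smooth_functions_const bundle_manifold
        cutoff_frame_section[OF U(1) \<rho>(1) K])
  from that[OF this] show ?thesis using \<rho>(2) inv by simp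
qed

text \<open>
  This is the statement that a map on global sections that is linear over the smooth functions comes
  from a bundle map. The coordinates \<open>y\<^sub>b\<close> of \<open>Y\<close> and the frame \<open>e\<^sub>b\<close> live on \<open>U\<close> only; multiplying each of
  them by a bump function \<open>\<rho>\<close> makes them global, at the price of the factor \<open>\<rho>\<^sup>2\<close>, which can be divided
  out on the open set \<open>N\<close> where \<open>\<rho>\<close> does not vanish.
\<close>

lemma oneform_local_expansion:
  fixes \<omega> :: "('m, 'v) oneform"
  assumes add: "\<And>Y Z. Y \<in> sections A \<Longrightarrow> Z \<in> sections A \<Longrightarrow> \<omega> (\<lambda>p. Y p + Z p) = (\<lambda>p. \<omega> Y p + \<omega> Z p)"
    and scale: "\<And>f Y. f \<in> smooth_functions (atlas A) \<Longrightarrow> Y \<in> sections A \<Longrightarrow>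
      \<omega> (\<lambda>p. f p *\<^sub>R Y p) = (\<lambda>p. f p * \<omega> Y p)"
    and smooth: "\<And>Y. Y \<in> sections A \<Longrightarrow> \<omega> Y \<in> smooth_functions (atlas A)"
    and B: "finite B" "independent B" "span B = UNIV"
    and p0: "(U, \<tau>) \<in> trivs A" "p0 \<in> U"
  obtains N w where "open N" "p0 \<in> N" "N \<subseteq> U" "\<And>b. smooth_map_on (atlas A) N (w b)"
    "\<And>Y p. Y \<in> sections A \<Longrightarrow> p \<in> N \<Longrightarrow> \<omega> Y p = (\<Sum>b\<in>B. representation B (\<tau> p (Y p)) b * w b p)"
proof -
  note U = p0(1) note M = bundle_manifold
  obtain \<rho> K where \<rho>: "\<rho> \<in> smooth_functions (atlas A)" "\<rho> p0 \<noteq> 0"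
    and K: "closed K" "K \<subseteq> U" "\<And>p. p \<notin> K \<Longrightarrow> \<rho> p = 0"
    by (rule smooth_bump_on_manifold[OF M triv_open[OF U] p0(2)]) blast
  have sm\<rho>: "smooth_map_on (atlas A) W \<rho>" for W
    using \<rho>(1) smooth_map_on_subset unfolding smooth_functions_def by blast
  define E where "E b p = \<rho> p *\<^sub>R frame_vector A \<tau> p b" for b p
  have E: "E b \<in> sections A" for b
    unfolding E_def[abs_def] by (rule cutoff_frame_section[OF U \<rho>(1) K])
  define N where "N = {p. \<rho> p \<noteq> 0}"
  have "continuous_on UNIV \<rho>" by (rule smooth_map_on_continuous[OF M open_UNIV sm\<rho>])
  then have oN: "open N"
    unfolding N_def by (intro open_Collect_neq continuous_on_const)
  define w where "w b p = inverse (\<rho> p) * \<omega> (E b) p" for b p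
  have w: "smooth_map_on (atlas A) N (w b)" for b
    unfolding w_def[abs_def] using smooth[OF E, of b]
    by (intro smooth_map_on_mult smooth_map_on_inverse M oN sm\<rho>)
      (auto simp: N_def smooth_functions_def intro: smooth_map_on_subset)
  have sum\<omega>: "\<omega> (\<lambda>p. \<Sum>i\<in>I. f i p *\<^sub>R X i p) = (\<lambda>p. \<Sum>i\<in>I. f i p * \<omega> (X i) p)"
    if "finite I" "\<And>i. i \<in> I \<Longrightarrow> f i \<in> smooth_functions (atlas A)" "\<And>i. i \<in> I \<Longrightarrow> X i \<in> sections A"
    for I :: "'f set" and f X
    using that
  proof (induction I)
    case empty
    have "\<omega> (\<lambda>p. (0::real) *\<^sub>R E 0 p) = (\<lambda>p. 0 * \<omega> (E 0) p)"
      by (rule scale[OF smooth_functions_const[OF M] E])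
    then show ?case by simp
  next
    case (insert i I)
    then show ?case
      using add[OF section_scale[of "f i" "X i"] section_linear_combination[of I f X]]
      by (simp add: scale)
  qed
  have exp: "\<omega> Y p = (\<Sum>b\<in>B. representation B (\<tau> p (Y p)) b * w b p)" if Y: "Y \<in> sections A" and p: "p \<in> N" for Y p
  proof -
    define y where "y b p = \<rho> p * representation B (\<tau> p (Y p)) b" for b p
    have y: "y b \<in> smooth_functions (atlas A)" for b
    proof -
      have "smooth_map_on (atlas A) UNIV (\<lambda>p. \<rho> p *\<^sub>R representation B (\<tau> p (Y p)) b)"
        using section_coordinate_smooth[OF Y U B]
        by (intro smooth_map_on_extend_by_zero[OF M open_UNIV triv_open[OF U] \<rho>(1) K]) auto
      then show ?thesis by (simp add: smooth_functions_def y_def[abs_def])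
    qed
    \<comment> \<open>An identity of global sections: both sides vanish outside \<open>U\<close>.\<close>
    have "(\<lambda>q. (\<rho> q * \<rho> q) *\<^sub>R Y q) = (\<lambda>q. \<Sum>b\<in>B. y b q *\<^sub>R E b q)"
    proof
      fix q
      show "(\<rho> q * \<rho> q) *\<^sub>R Y q = (\<Sum>b\<in>B. y b q *\<^sub>R E b q)"
      proof (cases "q \<in> U")
        case True
        have "(\<rho> q * \<rho> q) *\<^sub>R Y q = (\<rho> q * \<rho> q) *\<^sub>R
            (\<Sum>b\<in>B. representation B (\<tau> q (Y q)) b *\<^sub>R frame_vector A \<tau> q b)"
          using frame_expansion[OF U True section_in_fibre[OF Y] B] by simp
        then show ?thesis by (simp add: y_def E_def scaleR_sum_right mult_ac)
      next
        case False
        then have "\<rho> q = 0" using K by blast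
        then show ?thesis by (simp add: y_def)
      qed
    qed
    then have "\<omega> (\<lambda>q. (\<rho> q * \<rho> q) *\<^sub>R Y q) p = (\<Sum>b\<in>B. y b p * \<omega> (E b) p)"
      using sum\<omega>[OF B(1) y E] by simp
    then have "\<rho> p * \<rho> p * \<omega> Y p = (\<Sum>b\<in>B. y b p * \<omega> (E b) p)"
      using scale[OF smooth_functions_mult[OF M \<rho>(1) \<rho>(1)] Y] by simp
    also have "\<dots> = \<rho> p * \<rho> p * (\<Sum>b\<in>B. representation B (\<tau> p (Y p)) b * w b p)"
      using p by (simp add: y_def w_def N_def sum_distrib_left field_simps)
    finally show ?thesis using p by (simp add: N_def)
  qed
  show ?thesis
    by (rule that[of N w]) (use oN \<rho>(2) K w exp in \<open>auto simp: N_def\<close>)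
qed

end

section \<open>Representation of one-forms by a pseudo-Riemannian metric\<close>

context
  fixes A :: "('m::{t2_space,second_countable_topology}, 'e::real_normed_vector, 'v::real_vector,
    'f::real_normed_vector) algebroid" and g :: "'m \<Rightarrow> 'v \<Rightarrow> 'v \<Rightarrow> real"
  assumes A: "vector_bundle A" and g: "pseudo_riemannian_metric A g"
begin

lemma metric_symmetric:
  assumes "u \<in> fibre A p" "v \<in> fibre A p"
  shows "g p u v = g p v u"
proof -
  have "\<forall>p. \<forall>u\<in>fibre A p. \<forall>v\<in>fibre A p. g p u v = g p v u"
    using g unfolding pseudo_riemannian_metric_def by (elim conjE)
  then show ?thesis using assms by simp
qed

lemma metric_linear_left:
  assumes "u \<in> fibre A p" "v \<in> fibre A p" "w \<in> fibre A p"
  shows "g p (a *\<^sub>R u + b *\<^sub>R v) w = a * g p u w + b * g p v w"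
proof -
  have "\<forall>p. \<forall>u\<in>fibre A p. \<forall>v\<in>fibre A p. \<forall>w\<in>fibre A p. \<forall>a b.
      g p (a *\<^sub>R u + b *\<^sub>R v) w = a * g p u w + b * g p v w"
    using g unfolding pseudo_riemannian_metric_def by (elim conjE)
  then show ?thesis using assms by simp
qed

lemma metric_linear_right:
  assumes "u \<in> fibre A p" "v \<in> fibre A p" "w \<in> fibre A p"
  shows "g p w (a *\<^sub>R u + b *\<^sub>R v) = a * g p w u + b * g p w v"
proof -
  have "a *\<^sub>R u + b *\<^sub>R v \<in> fibre A p"
    using assms by (intro subspace_add subspace_scale fibre_subspace[OF A])
  then show ?thesis
    using assms by (simp add: metric_symmetric[of w] metric_linear_left)
qed

lemma metric_nondegenerate:
  assumes "v \<in> fibre A p" "\<And>w. w \<in> fibre A p \<Longrightarrow> g p v w = 0"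
  shows "v = 0"
proof -
  have "\<forall>p. \<forall>v\<in>fibre A p. (\<forall>w\<in>fibre A p. g p v w = 0) \<longrightarrow> v = 0"
    using g unfolding pseudo_riemannian_metric_def by (elim conjE)
  then show ?thesis using assms by simp
qed

lemma metric_frame_smooth:
  assumes "(U, \<tau>) \<in> trivs A"
  shows "smooth_map_on (atlas A) U (\<lambda>p. g p (frame_vector A \<tau> p v) (frame_vector A \<tau> p w))"
proof -
  have "\<forall>(U, \<tau>)\<in>trivs A. \<forall>v w. smooth_map_on (atlas A) U
      (\<lambda>p. g p (frame_vector A \<tau> p v) (frame_vector A \<tau> p w))"
    using g unfolding pseudo_riemannian_metric_def by (elim conjE)
  from bspec[OF this assms] show ?thesis by simp
qed

lemma metric_apply_smooth:
  assumes X: "X \<in> sections A" and Y: "Y \<in> sections A"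
  shows "metric_apply g X Y \<in> smooth_functions (atlas A)"
proof (rule smooth_functionsI[OF A])
  fix U \<tau> assume U: "(U, \<tau>) \<in> trivs A"
  have "smooth_map_on (atlas A) U (\<lambda>p. g p (X p) (Y p))"
  proof (rule fibrewise_linear_smooth[OF A U X])
    show "smooth_map_on (atlas A) U (\<lambda>p. g p (frame_vector A \<tau> p w) (Y p))" for w
      by (rule fibrewise_linear_smooth[OF A U Y])
        (auto intro: metric_linear_right metric_frame_smooth[OF U] frame_vector_in_fibre[OF A U])
  qed (auto intro: metric_linear_left section_in_fibre[OF A Y])
  then show "smooth_map_on (atlas A) U (metric_apply g X Y)" by (simp add: metric_apply_def[abs_def])
qed

text \<open>
  Sections take all values in a fibre, so nondegeneracy on the fibre applies.
\<close>

lemma metric_representative_unique: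
  assumes s: "s \<in> fibre A p" "s' \<in> fibre A p"
    and eq: "\<And>Y. Y \<in> sections A \<Longrightarrow> g p s (Y p) = g p s' (Y p)"
  shows "s = s'"
proof -
  have "s - s' = 0"
  proof (rule metric_nondegenerate)
    show "s - s' \<in> fibre A p" using s by (simp add: subspace_diff fibre_subspace[OF A])
    fix w assume w: "w \<in> fibre A p"
    then obtain Y where "Y \<in> sections A" "Y p = w" using section_through[OF A] by blast
    then show "g p (s - s') w = 0"
      using metric_linear_left[OF s w, of 1 "-1"] eq by auto
  qed
  then show ?thesis by simp
qed

text \<open>
  In a frame, representing \<open>\<omega>\<close> means solving \<open>\<Sum>\<^sub>a c\<^sub>a g(e\<^sub>a, e\<^sub>b) = w\<^sub>b\<close>, where \<open>w\<^sub>b\<close> are the coefficients of \<open>\<omega>\<close>.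
  The Gram matrix is nonsingular because \<open>g\<close> is nondegenerate.
\<close>

lemma oneform_local_representative:
  fixes \<omega> :: "('m, 'v) oneform"
  assumes add: "\<And>Y Z. Y \<in> sections A \<Longrightarrow> Z \<in> sections A \<Longrightarrow> \<omega> (\<lambda>p. Y p + Z p) = (\<lambda>p. \<omega> Y p + \<omega> Z p)"
    and scale: "\<And>f Y. f \<in> smooth_functions (atlas A) \<Longrightarrow> Y \<in> sections A \<Longrightarrow>
      \<omega> (\<lambda>p. f p *\<^sub>R Y p) = (\<lambda>p. f p * \<omega> Y p)"
    and smooth: "\<And>Y. Y \<in> sections A \<Longrightarrow> \<omega> Y \<in> smooth_functions (atlas A)"
  obtains N S where "open N" "p0 \<in> N" "\<And>p. p \<in> N \<Longrightarrow> S p \<in> fibre A p"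
    "\<And>V \<sigma>. (V, \<sigma>) \<in> trivs A \<Longrightarrow> smooth_map_on (atlas A) (V \<inter> N) (\<lambda>p. \<sigma> p (S p))"
    "\<And>Y p. Y \<in> sections A \<Longrightarrow> p \<in> N \<Longrightarrow> g p (S p) (Y p) = \<omega> Y p"
proof -
  note M = bundle_manifold[OF A]
  obtain B :: "'f set" where B: "finite B" "independent B" "span B = UNIV"
    using finite_dim_basis[OF bundle_finite_dim[OF A]] .
  obtain U \<tau> where U: "(U, \<tau>) \<in> trivs A" "p0 \<in> U" by (rule triv_at[OF A])
  obtain N w where N: "open N" "p0 \<in> N" "N \<subseteq> U" and w: "\<And>b. smooth_map_on (atlas A) N (w b)"
    and \<omega>: "\<And>Y p. Y \<in> sections A \<Longrightarrow> p \<in> N \<Longrightarrow>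
      \<omega> Y p = (\<Sum>b\<in>B. representation B (\<tau> p (Y p)) b * w b p)"
    by (rule oneform_local_expansion[OF A add scale smooth B U]) blast+
  let ?e = "frame_vector A \<tau>"
  have e: "?e p b \<in> fibre A p" if "p \<in> N" for p b
    using frame_vector_in_fibre[OF A U(1)] that N(3) by blast
  define G where "G a b p = g p (?e p a) (?e p b)" for a b p
  have G: "smooth_map_on (atlas A) N (G a b)" for a b
    using metric_frame_smooth[OF U(1)] N(3) unfolding G_def[abs_def] by (rule smooth_map_on_subset)
  have sum_left: "g p (\<Sum>a\<in>B. c a *\<^sub>R ?e p a) v = (\<Sum>a\<in>B. c a * g p (?e p a) v)"
    if "p \<in> N" "v \<in> fibre A p" for p c v
    using linear_combination_on_subspace[OF fibre_subspace[OF A, of p], of "\<lambda>u. g p u v" B "?e p" c]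
      metric_linear_left e that by simp
  have sum_right: "g p v (\<Sum>b\<in>B. c b *\<^sub>R ?e p b) = (\<Sum>b\<in>B. c b * g p v (?e p b))"
    if "p \<in> N" "v \<in> fibre A p" for p c v
    using linear_combination_on_subspace[OF fibre_subspace[OF A, of p], of "g p v" B "?e p" c]
      metric_linear_right e that by simp
  have comb: "(\<Sum>a\<in>B. c a *\<^sub>R ?e p a) \<in> fibre A p" if "p \<in> N" for p c
    using that by (intro subspace_sum subspace_scale fibre_subspace[OF A] e)
  have expand: "v = (\<Sum>b\<in>B. representation B (\<tau> p v) b *\<^sub>R ?e p b)" if "p \<in> N" "v \<in> fibre A p" for p v
    using frame_expansion[OF A U(1) _ that(2) B] that(1) N(3) by blast
  have g_expand: "g p s v = (\<Sum>b\<in>B. representation B (\<tau> p v) b * g p s (?e p b))"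
    if "p \<in> N" "s \<in> fibre A p" "v \<in> fibre A p" for p s v
    using trans[OF arg_cong[OF expand[OF that(1,3)], of "g p s"] sum_right[OF that(1,2)]] .
  have nondeg: "\<forall>a\<in>B. c a = 0" if p: "p \<in> N" and c: "\<forall>b\<in>B. (\<Sum>a\<in>B. c a * G a b p) = 0" for p c
  proof -
    let ?s = "\<Sum>a\<in>B. c a *\<^sub>R ?e p a"
    have "?s = 0"
    proof (rule metric_nondegenerate[OF comb[OF p]])
      fix v assume v: "v \<in> fibre A p"
      show "g p ?s v = 0"
        using c sum_left[OF p e[OF p]] by (subst g_expand[OF p comb[OF p] v]) (simp add: G_def)
    qed
    moreover have pU: "p \<in> U" using p N(3) by blast
    ultimately have "(\<Sum>a\<in>B. c a *\<^sub>R a) = 0"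
      using triv_linear_combination[OF A U(1) pU, of B "?e p" c] e[OF p]
        triv_linear_combination[OF A U(1) pU, of "{}"]
      by (simp add: triv_frame_vector[OF A U(1) pU])
    then show ?thesis using B independentD by blast
  qed
  obtain c where c: "\<And>b. b \<in> B \<Longrightarrow> c b \<in> {f. smooth_map_on (atlas A) N f}"
    "\<And>p b. p \<in> N \<Longrightarrow> b \<in> B \<Longrightarrow> (\<Sum>a\<in>B. c a p * G a b p) = w b p"
    by (rule cramer_in_function_algebra[of "{f. smooth_map_on (atlas A) N f}" N B G w])
      (use G w nondeg B N(1) M in \<open>auto intro: smooth_map_on_const smooth_map_on_add smooth_map_on_mult
        smooth_map_on_inverse\<close>)
  define S where "S p = (\<Sum>a\<in>B. c a p *\<^sub>R ?e p a)" for p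
  have "smooth_map_on (atlas A) (V \<inter> N) (\<lambda>p. \<sigma> p (S p))" if V: "(V, \<sigma>) \<in> trivs A" for V \<sigma>
  proof -
    have o: "open (V \<inter> N)" using triv_open[OF A V] N by blast
    have "smooth_map_on (atlas A) (V \<inter> N) (\<lambda>p. \<Sum>a\<in>B. c a p *\<^sub>R \<sigma> p (?e p a))"
    proof (intro smooth_map_on_sum smooth_map_on_scaleR M o)
      show "smooth_map_on (atlas A) (V \<inter> N) (\<lambda>p. \<sigma> p (?e p a))" for a
        by (rule smooth_map_on_subset[OF frame_vector_smooth[OF A U(1) V]]) (use N(3) in auto)
    qed (use c(1) in \<open>auto intro: smooth_map_on_subset\<close>)
    then show ?thesis
      by (rule smooth_map_on_cong[OF M o, rotated])
        (auto simp: S_def triv_linear_combination[OF A V] e)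
  qed
  moreover have "g p (S p) (Y p) = \<omega> Y p" if Y: "Y \<in> sections A" and p: "p \<in> N" for Y p
  proof -
    let ?y = "representation B (\<tau> p (Y p))"
    have "g p (S p) (Y p) = (\<Sum>b\<in>B. ?y b * g p (S p) (?e p b))"
      unfolding S_def by (rule g_expand[OF p comb[OF p] section_in_fibre[OF A Y]])
    also have "\<dots> = (\<Sum>b\<in>B. ?y b * w b p)"
      using sum_left[OF p e[OF p]] c(2)[OF p] by (simp add: S_def G_def)
    finally show ?thesis using \<omega>[OF Y p] by simp
  qed
  ultimately show ?thesis
    by (intro that[of N S] N) (auto simp: S_def comb)
qed

text \<open>
  Local representatives agree on overlaps by uniqueness in each fibre, so they glue. The global
  section is therefore defined pointwise, and its smoothness is read off from the local ones.
\<close>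

lemma musical_isomorphism:
  fixes \<omega> :: "('m, 'v) oneform"
  assumes add: "\<And>Y Z. Y \<in> sections A \<Longrightarrow> Z \<in> sections A \<Longrightarrow> \<omega> (\<lambda>p. Y p + Z p) = (\<lambda>p. \<omega> Y p + \<omega> Z p)"
    and scale: "\<And>f Y. f \<in> smooth_functions (atlas A) \<Longrightarrow> Y \<in> sections A \<Longrightarrow>
      \<omega> (\<lambda>p. f p *\<^sub>R Y p) = (\<lambda>p. f p * \<omega> Y p)"
    and smooth: "\<And>Y. Y \<in> sections A \<Longrightarrow> \<omega> Y \<in> smooth_functions (atlas A)"
  obtains S where "S \<in> sections A" "\<And>Y. Y \<in> sections A \<Longrightarrow> metric_apply g S Y = \<omega> Y"
proof -
  define S where "S p = (THE s. s \<in> fibre A p \<and> (\<forall>Y\<in>sections A. g p s (Y p) = \<omega> Y p))" for p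
  have S_eq: "S p = s" if "s \<in> fibre A p" "\<And>Y. Y \<in> sections A \<Longrightarrow> g p s (Y p) = \<omega> Y p" for p s
    unfolding S_def using that by (intro the_equality) (auto intro!: metric_representative_unique)
  have local: "\<exists>N. open N \<and> p0 \<in> N \<and>
      (\<forall>p\<in>N. S p \<in> fibre A p \<and> (\<forall>Y\<in>sections A. g p (S p) (Y p) = \<omega> Y p)) \<and>
      (\<forall>V \<sigma>. (V, \<sigma>) \<in> trivs A \<longrightarrow> smooth_map_on (atlas A) (V \<inter> N) (\<lambda>p. \<sigma> p (S p)))" for p0
  proof -
    obtain N T where N: "open N" "p0 \<in> N" and T: "\<And>p. p \<in> N \<Longrightarrow> T p \<in> fibre A p"
      "\<And>V \<sigma>. (V, \<sigma>) \<in> trivs A \<Longrightarrow> smooth_map_on (atlas A) (V \<inter> N) (\<lambda>p. \<sigma> p (T p))"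
      "\<And>Y p. Y \<in> sections A \<Longrightarrow> p \<in> N \<Longrightarrow> g p (T p) (Y p) = \<omega> Y p"
      by (rule oneform_local_representative[OF add scale smooth, of p0]) blast+
    have ST: "S p = T p" if "p \<in> N" for p using T(1,3) that by (intro S_eq) auto
    have "smooth_map_on (atlas A) (V \<inter> N) (\<lambda>p. \<sigma> p (S p))" if V: "(V, \<sigma>) \<in> trivs A" for V \<sigma>
      by (rule smooth_map_on_cong[OF bundle_manifold[OF A] _ _ T(2)[OF V]])
        (use triv_open[OF A V] N ST in auto)
    then show ?thesis using N T ST by (intro exI[of _ N]) auto
  qed
  have "S \<in> sections A"
  proof (rule sectionI[OF A])
    show "S p \<in> fibre A p" for p using local by blast
    fix V \<sigma> assume V: "(V, \<sigma>) \<in> trivs A"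
    show "smooth_map_on (atlas A) V (\<lambda>p. \<sigma> p (S p))"
    proof (rule smooth_map_on_locally[OF bundle_manifold[OF A]])
      fix p assume "p \<in> V"
      then show "\<exists>W. open W \<and> p \<in> W \<and> smooth_map_on (atlas A) W (\<lambda>p. \<sigma> p (S p))"
        using local[of p] V triv_open[OF A V] by (meson IntI open_Int)
    qed
  qed
  moreover have "metric_apply g S Y = \<omega> Y" if "Y \<in> sections A" for Y
    using local that unfolding metric_apply_def by blast
  ultimately show ?thesis using that by blast
qed

lemma sharp_eqI:
  assumes S: "S \<in> sections A" "\<And>Y. Y \<in> sections A \<Longrightarrow> metric_apply g S Y = \<omega> Y"
  shows "sharp A g \<omega> = S"
  unfolding sharp_def
proof (rule the_equality)
  fix T assume T: "T \<in> sections A \<and> (\<forall>Y\<in>sections A. metric_apply g T Y = \<omega> Y)"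
  show "T = S"
  proof
    fix p
    have "g p (T p) (Y p) = g p (S p) (Y p)" if "Y \<in> sections A" for Y
    proof -
      have "metric_apply g T Y = metric_apply g S Y" using S T that by simp
      from fun_cong[OF this, of p] show ?thesis by (simp add: metric_apply_def)
    qed
    then show "T p = S p"
      using S T by (intro metric_representative_unique) (auto intro: section_in_fibre[OF A])
  qed
qed (use S in auto)

end

section \<open>Anchor and bracket\<close>

context
  fixes A :: "('m::{t2_space,second_countable_topology}, 'e::real_normed_vector, 'v::real_vector,
    'f::real_normed_vector) algebroid"
  assumes A: "skew_symmetric_algebroid A"
begin

lemma algebroid_bundle: "vector_bundle A"
  and algebroid_anchor: "anchor_map A"
  using A by (simp_all add: skew_symmetric_algebroid_def)

lemma anchor_linear:
  "v \<in> fibre A p \<Longrightarrow> w \<in> fibre A p \<Longrightarrow> f \<in> smooth_functions (atlas A) \<Longrightarrow>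
    anchor A p (a *\<^sub>R v + b *\<^sub>R w) f = a * anchor A p v f + b * anchor A p w f"
  using algebroid_anchor unfolding anchor_map_def by blast

lemma deriv_along_smooth:
  assumes X: "X \<in> sections A" and f: "f \<in> smooth_functions (atlas A)"
  shows "deriv_along A X f \<in> smooth_functions (atlas A)"
proof (rule smooth_functionsI[OF algebroid_bundle])
  fix U \<tau> assume U: "(U, \<tau>) \<in> trivs A"
  have "smooth_map_on (atlas A) U (\<lambda>p. anchor A p (X p) f)"
  proof (rule fibrewise_linear_smooth[OF algebroid_bundle U X])
    show "smooth_map_on (atlas A) U (\<lambda>p. anchor A p (frame_vector A \<tau> p w) f)" for w
      using algebroid_anchor U f unfolding anchor_map_def by (elim conjE) fast
  qed (auto intro: anchor_linear f)
  then show "smooth_map_on (atlas A) U (deriv_along A X f)" by (simp add: deriv_along_def)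
qed

lemma deriv_along_tangent:
  assumes "X \<in> sections A"
  shows "tangent_vector (atlas A) p (anchor A p (X p))"
  using algebroid_anchor section_in_fibre[OF algebroid_bundle assms] unfolding anchor_map_def by blast

lemma deriv_along_add:
  assumes "X \<in> sections A" "f \<in> smooth_functions (atlas A)" "h \<in> smooth_functions (atlas A)"
  shows "deriv_along A X (\<lambda>q. f q + h q) p = deriv_along A X f p + deriv_along A X h p"
  using deriv_along_tangent[OF assms(1), of p] assms(2,3)
  by (simp add: tangent_vector_def deriv_along_def)

lemma deriv_along_mult:
  assumes "X \<in> sections A" "f \<in> smooth_functions (atlas A)" "h \<in> smooth_functions (atlas A)"
  shows "deriv_along A X (\<lambda>q. f q * h q) p = f p * deriv_along A X h p + h p * deriv_along A X f p"
  using deriv_along_tangent[OF assms(1), of p] assms(2,3)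
  by (simp add: tangent_vector_def deriv_along_def)

lemma bracket_section: "X \<in> sections A \<Longrightarrow> Y \<in> sections A \<Longrightarrow> bracket A X Y \<in> sections A"
  using A unfolding skew_symmetric_algebroid_def by blast

lemma bracket_add:
  assumes "X \<in> sections A" "Y \<in> sections A" "Z \<in> sections A"
  shows "bracket A X (\<lambda>p. Y p + Z p) = (\<lambda>p. bracket A X Y p + bracket A X Z p)"
proof -
  have "\<forall>X\<in>sections A. \<forall>Y\<in>sections A. \<forall>Z\<in>sections A. \<forall>a b.
      bracket A (\<lambda>p. a *\<^sub>R X p + b *\<^sub>R Y p) Z =
        (\<lambda>p. a *\<^sub>R bracket A X Z p + b *\<^sub>R bracket A Y Z p) \<and>
      bracket A Z (\<lambda>p. a *\<^sub>R X p + b *\<^sub>R Y p) =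
        (\<lambda>p. a *\<^sub>R bracket A Z X p + b *\<^sub>R bracket A Z Y p)"
    using A unfolding skew_symmetric_algebroid_def by (elim conjE)
  from conjunct2[OF this[rule_format, OF assms(2,3,1), of 1 1]] show ?thesis by simp
qed

lemma bracket_scale:
  assumes "X \<in> sections A" "Y \<in> sections A" "f \<in> smooth_functions (atlas A)"
  shows "bracket A X (\<lambda>p. f p *\<^sub>R Y p) = (\<lambda>p. f p *\<^sub>R bracket A X Y p + deriv_along A X f p *\<^sub>R Y p)"
proof -
  have "\<forall>X\<in>sections A. \<forall>Y\<in>sections A. \<forall>f\<in>smooth_functions (atlas A).
      bracket A X (\<lambda>p. f p *\<^sub>R Y p) = (\<lambda>p. f p *\<^sub>R bracket A X Y p + deriv_along A X f p *\<^sub>R Y p)"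
    using A unfolding skew_symmetric_algebroid_def by (elim conjE)
  then show ?thesis using assms by simp
qed

end

section \<open>The diagonal of a connection\<close>

text \<open>
  The form \<open>\<L>\<^sub>X X\<^sup>\<flat> - 1/2 d(g(X,X))\<close>. For a torsion-free metric connection it is dual to \<open>\<nabla>\<^sub>X X\<close>, by the
  diagonal case of the Koszul formula.
\<close>

definition lie_metric_form ::
  "('m, 'e, 'v, 'f) algebroid \<Rightarrow> ('m \<Rightarrow> 'v \<Rightarrow> 'v \<Rightarrow> real) \<Rightarrow> ('m \<Rightarrow> 'v) \<Rightarrow> ('m, 'v) oneform" where
  "lie_metric_form A g X =
    (\<lambda>Y q. lie_alt A X (flat g X) Y q - 1 / 2 * d_alt A (metric_apply g X X) Y q)"

lemma lie_metric_form_apply: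
  "lie_metric_form A g X Y p = deriv_along A X (metric_apply g X Y) p
    - metric_apply g X (bracket A X Y) p - 1 / 2 * deriv_along A Y (metric_apply g X X) p"
  by (simp add: lie_metric_form_def lie_alt_def flat_def d_alt_def)

context
  fixes A :: "('m::{t2_space,second_countable_topology}, 'e::real_normed_vector, 'v::real_vector,
    'f::real_normed_vector) algebroid" and g :: "'m \<Rightarrow> 'v \<Rightarrow> 'v \<Rightarrow> real"
  assumes A: "skew_symmetric_algebroid A" and g: "pseudo_riemannian_metric A g"
begin

text \<open>
  The form is linear over the smooth functions, although two of its terms are not: replacing
  \<open>Y\<close> by \<open>f Y\<close> adds \<open>(X f) g(X,Y)\<close> to both \<open>X g(X,Y)\<close> and \<open>g(X,[X,Y])\<close>, which
  enter with opposite signs.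
\<close>

lemma sharp_lie_metric_form:
  assumes X: "X \<in> sections A"
  shows "sharp A g (lie_metric_form A g X) \<in> sections A"
    and "Y \<in> sections A \<Longrightarrow> metric_apply g (sharp A g (lie_metric_form A g X)) Y = lie_metric_form A g X Y"
proof -
  note VB = algebroid_bundle[OF A] and smooth = metric_apply_smooth[OF algebroid_bundle[OF A] g]
  note M = bundle_manifold[OF VB] and fib = section_in_fibre[OF VB]
  let ?\<omega> = "lie_metric_form A g X"
  have g_comb: "metric_apply g X (\<lambda>p. f p *\<^sub>R Y p + h p *\<^sub>R Z p) =
      (\<lambda>p. f p * metric_apply g X Y p + h p * metric_apply g X Z p)"
    if "Y \<in> sections A" "Z \<in> sections A" for f h Y Z
    using metric_linear_right[OF VB g fib fib fib, OF that X] by (simp add: metric_apply_def)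
  obtain S where "S \<in> sections A" "\<And>Y. Y \<in> sections A \<Longrightarrow> metric_apply g S Y = ?\<omega> Y"
  proof (rule musical_isomorphism[OF VB g, of ?\<omega>])
    fix Y Z assume Y: "Y \<in> sections A" and Z: "Z \<in> sections A"
    have g_add: "metric_apply g X (\<lambda>p. V p + W p) = (\<lambda>p. metric_apply g X V p + metric_apply g X W p)"
      if "V \<in> sections A" "W \<in> sections A" for V W
      using g_comb[OF that, of "\<lambda>_. 1" "\<lambda>_. 1"] by simp
    show "?\<omega> (\<lambda>p. Y p + Z p) = (\<lambda>p. ?\<omega> Y p + ?\<omega> Z p)"
      using anchor_linear[OF A fib[OF Y] fib[OF Z] smooth[OF X X], of _ 1 1]
      by (auto simp: lie_metric_form_apply g_add Y Z X bracket_section[OF A] bracket_add[OF A]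
          deriv_along_add[OF A] smooth deriv_along_def[of A "\<lambda>p. Y p + Z p"]
          deriv_along_def[of A Y "metric_apply g X X"] deriv_along_def[of A Z "metric_apply g X X"]
          field_simps)
  next
    fix f Y assume f: "f \<in> smooth_functions (atlas A)" and Y: "Y \<in> sections A"
    have gf: "metric_apply g X (\<lambda>p. f p *\<^sub>R Y p) = (\<lambda>p. f p * metric_apply g X Y p)"
      using g_comb[OF Y Y, of f "\<lambda>_. 0"] by simp
    have af: "deriv_along A (\<lambda>p. f p *\<^sub>R Y p) h p = f p * deriv_along A Y h p"
      if "h \<in> smooth_functions (atlas A)" for h p
      using anchor_linear[OF A fib[OF Y] fib[OF Y] that, of _ "f p" 0] by (simp add: deriv_along_def)
    show "?\<omega> (\<lambda>p. f p *\<^sub>R Y p) = (\<lambda>p. f p * ?\<omega> Y p)"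
      by (auto simp: lie_metric_form_apply gf af bracket_scale[OF A] g_comb bracket_section[OF A]
          deriv_along_mult[OF A] X Y f smooth algebra_simps)
  next
    fix Y assume Y: "Y \<in> sections A"
    have "(\<lambda>p. deriv_along A X (metric_apply g X Y) p +
        ((- 1) * metric_apply g X (bracket A X Y) p + (- 1 / 2) * deriv_along A Y (metric_apply g X X) p))
        \<in> smooth_functions (atlas A)"
      using deriv_along_smooth[OF A X smooth[OF X Y]] deriv_along_smooth[OF A Y smooth[OF X X]]
        smooth[OF X bracket_section[OF A X Y]]
      unfolding smooth_functions_def mem_Collect_eq
      by (intro smooth_map_on_add smooth_map_on_mult smooth_map_on_const M open_UNIV)
    then show "?\<omega> Y \<in> smooth_functions (atlas A)"
      by (simp add: lie_metric_form_apply[abs_def] algebra_simps)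
  qed blast
  then show "sharp A g ?\<omega> \<in> sections A"
    and "Y \<in> sections A \<Longrightarrow> metric_apply g (sharp A g ?\<omega>) Y = ?\<omega> Y"
    using sharp_eqI[OF VB g, of S ?\<omega>] by auto
qed

text \<open>
  With \<open>(\<nabla>\<^sub>X g)(X,Z) = X g(X,Z) - g(\<nabla>\<^sub>X X, Z) - g(X, \<nabla>\<^sub>X Z)\<close> and
  \<open>(\<nabla>\<^sub>Z g)(X,X) = Z g(X,X) - 2 g(\<nabla>\<^sub>Z X, X)\<close>, and with
  \<open>d\<^sup>s g (X,X,Z) = 2 (\<nabla>\<^sub>X g)(X,Z) + (\<nabla>\<^sub>Z g)(X,X)\<close>, the claim is a linear identity once \<open>\<nabla>\<^sub>X Z\<close> is eliminated
  through the torsion.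
\<close>

lemma connection_diagonal_formula:
  assumes nab: "algebroid_connection A nab" and X: "X \<in> sections A" and Z: "Z \<in> sections A"
  shows "metric_apply g (nab X X) Z p = lie_metric_form A g X Z p
             - metric_apply g (torsion A nab X Z) X p
             + total_cov_deriv A nab (metric_tensor g) [Z, X, X] p
             - 1 / 2 * sym_cov_deriv A nab (metric_tensor g) [X, X, Z] p"
proof -
  note VB = algebroid_bundle[OF A]
  note fib = section_in_fibre[OF VB]
  have nabS: "nab V W \<in> sections A" if "V \<in> sections A" "W \<in> sections A" for V W
    using nab that unfolding algebroid_connection_def by blast
  have sym: "metric_apply g V W = metric_apply g W V" if "V \<in> sections A" "W \<in> sections A" for V W
    using metric_symmetric[OF VB g fib fib, OF that] by (auto simp: metric_apply_def)
  have tor: "metric_apply g (torsion A nab X Z) X p = metric_apply g X (nab X Z) p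
      - metric_apply g X (nab Z X) p - metric_apply g X (bracket A X Z) p"
  proof -
    let ?a = "nab X Z p" and ?b = "nab Z X p" and ?c = "bracket A X Z p" and ?x = "X p"
    have f: "?a \<in> fibre A p" "?b \<in> fibre A p" "?c \<in> fibre A p" "?x \<in> fibre A p"
      using X Z by (simp_all add: fib nabS bracket_section[OF A])
    have d: "?a - ?b \<in> fibre A p" using f by (simp add: subspace_diff fibre_subspace[OF VB])
    have "g p (?a - ?b - ?c) ?x = g p ?a ?x - g p ?b ?x - g p ?c ?x"
      using metric_linear_left[OF VB g d f(3,4), of 1 "-1"] metric_linear_left[OF VB g f(1,2,4), of 1 "-1"]
      by simp
    then show ?thesis
      using f by (simp add: metric_apply_def torsion_def metric_symmetric[OF VB g])
  qed
  show ?thesis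
    using sym[OF nabS[OF X X] Z] sym[OF nabS[OF X X] X] sym[OF nabS[OF Z X] X] sym[OF nabS[OF X Z] X] sym[OF X Z]
    by (simp add: tor lie_metric_form_apply total_cov_deriv_def sym_cov_deriv_def cov_deriv_def
        metric_tensor_def lessThan_Suc numeral_2_eq_2 eval_nat_numeral field_simps)
qed

end

theorem theorem4p1:
  fixes A :: "('m::{t2_space,second_countable_topology}, 'e::real_normed_vector,
               'v::real_vector, 'f::real_normed_vector) algebroid"
    and g :: "'m \<Rightarrow> 'v \<Rightarrow> 'v \<Rightarrow> real"
    and nab :: "('m \<Rightarrow> 'v) \<Rightarrow> ('m \<Rightarrow> 'v) \<Rightarrow> ('m \<Rightarrow> 'v)"
  assumes "skew_symmetric_algebroid A"
    and "pseudo_riemannian_metric A g"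
    and "algebroid_connection A nab"
  shows "(\<forall>X\<in>sections A. \<forall>Z\<in>sections A. \<forall>p.
           metric_apply g (nab X X) Z p =
             metric_apply g
               (sharp A g (\<lambda>Y q. lie_alt A X (flat g X) Y q
                                 - 1 / 2 * d_alt A (metric_apply g X X) Y q)) Z p
             - metric_apply g (torsion A nab X Z) X p
             + total_cov_deriv A nab (metric_tensor g) [Z, X, X] p
             - 1 / 2 * sym_cov_deriv A nab (metric_tensor g) [X, X, Z] p) \<and>
         (totally_skew_torsion A g nab \<and> metric_compatible A g nab \<longrightarrow>
           (\<forall>X\<in>sections A.
              nab X X = sharp A g (\<lambda>Y q. lie_alt A X (flat g X) Y q
                                         - 1 / 2 * d_alt A (metric_apply g X X) Y q)))"
  unfolding lie_metric_form_def[symmetric]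
proof (intro conjI impI ballI allI)
  fix X Z p assume "X \<in> sections A" "Z \<in> sections A"
  then show "metric_apply g (nab X X) Z p =
      metric_apply g (sharp A g (lie_metric_form A g X)) Z p
      - metric_apply g (torsion A nab X Z) X p
      + total_cov_deriv A nab (metric_tensor g) [Z, X, X] p
      - 1 / 2 * sym_cov_deriv A nab (metric_tensor g) [X, X, Z] p"
    using connection_diagonal_formula[OF assms, of X Z p]
      sharp_lie_metric_form(2)[OF assms(1,2), of X Z] by simp
next
  fix X assume "totally_skew_torsion A g nab \<and> metric_compatible A g nab" and X: "X \<in> sections A"
  then have skew: "totally_skew_torsion A g nab" and compat: "metric_compatible A g nab" by simp_all
  show "nab X X = sharp A g (lie_metric_form A g X)"
  proof (rule sharp_eqI[OF algebroid_bundle[OF assms(1)] assms(2), symmetric])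
    show "nab X X \<in> sections A"
      using assms(3) X unfolding algebroid_connection_def by blast
    fix Z assume Z: "Z \<in> sections A"
    have cov: "cov_deriv A nab V (metric_tensor g) [W, W'] = (\<lambda>p. 0)"
      if "V \<in> sections A" "W \<in> sections A" "W' \<in> sections A" for V W W'
      using compat that by (auto simp: metric_compatible_def total_cov_deriv_def)
    have "\<And>Xs i j. length Xs = 3 \<Longrightarrow> set Xs \<subseteq> sections A \<Longrightarrow> i < 3 \<Longrightarrow> j < 3 \<Longrightarrow> i \<noteq> j \<Longrightarrow>
        torsion_tensor A g nab (Xs[i := Xs ! j, j := Xs ! i]) = (\<lambda>p. - torsion_tensor A g nab Xs p)"
      using skew unfolding totally_skew_torsion_def alternating_forms_def by simp
    \<comment> \<open>Exchanging the two outer arguments does not change \<open>T(X,Z,X)\<close>, so skewness makes it zero.\<close>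
    from this[of "[X, Z, X]" 0 2]
    have "torsion_tensor A g nab [X, Z, X] = (\<lambda>p. - torsion_tensor A g nab [X, Z, X] p)"
      using X Z by (simp add: numeral_2_eq_2)
    from fun_cong[OF this] have tor: "metric_apply g (torsion A nab X Z) X p = 0" for p
      by (simp add: torsion_tensor_def numeral_2_eq_2)
    show "metric_apply g (nab X X) Z = lie_metric_form A g X Z"
    proof
      fix p
      show "metric_apply g (nab X X) Z p = lie_metric_form A g X Z p"
        using connection_diagonal_formula[OF assms X Z, of p] cov X Z tor
        by (simp add: total_cov_deriv_def sym_cov_deriv_def eval_nat_numeral)
    qed
  qed
qed

end
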